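(* Let $\alpha\in\mathbb{R}$, $\alpha\neq0$, and let $\Sigma\subset\mathbb{R}^3$ be a $K^\alpha$-translator with speed $\vec{v}=(0,0,1)$. If $\Sigma$ is a helicoidal surface about the $z$-axis with pitch $h$, then $\Sigma$ is parametrized by $$X(U,t)=\left(\sqrt{U^2-h^2}\cos(t-\Theta(U)),\ \sqrt{U^2-h^2}\sin(t-\Theta(U)),\ f(U)+h(t-\Theta(U))\right),$$ where $U$ is the Bour function, $d\Theta=hU^{-2}df$ and $df$ is $$df=\begin{cases}\dfrac{\pm m^{-1}U}{U^2-h^2}\left(U^2\left(1-m^2e^{-U^2}\right)-h^2\right)^{\frac12}e^{\frac{U^2}{2}}\,dU, & \alpha=\frac12,\\[3mm] \dfrac{\pm U}{U^2-h^2}\left(U^2\left(1-\left(m-\frac{2\alpha-1}{2\alpha}U^2\right)^{\frac{2\alpha}{2\alpha-1}}\right)-h^2\right)^{\frac12}\left(m-\frac{2\alpha-1}{2\alpha}U^2\right)^{\frac{\alpha}{1-2\alpha}}dU, & \alpha\neq\frac12,\end{cases}$$ with $m\in\mathbb{R}$ ($m>0$ if $\alpha=1/2$).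
   Context: Let $\alpha\in\mathbb{R}$, $\alpha\ne 0$, and let $\vec{v}\in\mathbb{R}^3$ be a unit vector. A smooth surface $\Sigma$ in Euclidean space $\mathbb{R}^3$ with unit normal $N$ and Gauss curvature $K$ is called a $K^\alpha$-translator with speed $\vec{v}$ if $K^\alpha=\langle N,\vec{v}\rangle$ on $\Sigma$. The surface is not required to have $K>0$; it is implicitly assumed that $K^\alpha$ makes sense (for example, $K$ may be negative if $\alpha\in\mathbb{Z}$). Planes and surfaces of constant Gauss curvature are discarded throughout. A helicoidal surface about the $z$-axis with pitch $h\neq0$ is a surface invariant under the uniparametric group of helicoidal motions with axis the $z$-axis and pitch $h$; it is parametrized by $X(r,\theta)=(r\cos\theta,r\sin\theta,f(r)+h\theta)$, $r\in I\subset(0,\infty)$, $\theta\in\mathbb{R}$, with $f$ smooth. The Bour coordinates $(s,t)$ on such a surface are defined by $$ds=\left(1+\frac{r^2}{r^2+h^2}f'(r)^2\right)^{1/2}dr,\qquad t=\theta+\Theta,\qquad d\Theta=\frac{h}{r^2+h^2}f'(r)\,dr.$$ The Bour function $U$ is defined by $U^2=r^2+h^2$, so that the first fundamental form is $ds^2+U^2dt^2$. In the statement, $U$ is used as a coordinate in place of $s$ (or $r$), and $f$ and $\Theta$ are regarded as functions of $U$; $m$ is a constant of integration. *)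

theory Defs
  imports "HOL-Analysis.Analysis"
begin

section \<open>Real powers of possibly negative numbers\<close>

text \<open>
  The power $x^a$ makes sense for $x > 0$, for $x = 0$ if $a > 0$, and for $x < 0$ if $a$ is a
  rational number $p/q$ with $q$ odd (in particular if $a$ is an integer); in the last case
  $x^{p/q}$ is the $p$-th power of the real $q$-th root of $x$, so it has absolute value
  $|x|^{p/q}$ and the sign of $(-1)^p$; see \<open>rpow_neg_root\<close>. The parity of $p$ does not
  depend on the choice of the fraction, as long as $q$ is odd. The library function \<open>powr\<close>
  cannot be used directly, as it ignores the sign of its first argument.
\<close>

definition rpow_defined :: "real \<Rightarrow> real \<Rightarrow> bool" where
  "rpow_defined x a \<longleftrightarrow>
     x > 0 \<or> (x = 0 \<and> a > 0) \<or>
     (x < 0 \<and> (\<exists>p q :: int. odd q \<and> a = of_int p / of_int q))"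

definition rpow :: "real \<Rightarrow> real \<Rightarrow> real" where
  "rpow x a =
     (if x < 0 \<and> \<not> (\<exists>p q :: int. even p \<and> odd q \<and> a = of_int p / of_int q)
      then - (\<bar>x\<bar> powr a) else \<bar>x\<bar> powr a)"

lemma rpow_pos: "x > 0 \<Longrightarrow> rpow x a = x powr a"
  by (simp add: rpow_def)

lemma rpow_neg_root:
  assumes "x < 0" and "odd q"
  shows "rpow x (of_int p / of_nat q) = root q x powi p"
proof -
  have q0: "q > 0" using assms(2) by (cases q) auto
  have par: "(\<exists>p' q' :: int. even p' \<and> odd q' \<and> real_of_int p / real q = of_int p' / of_int q')
             \<longleftrightarrow> even p"
  proof
    assume "\<exists>p' q' :: int. even p' \<and> odd q' \<and> real_of_int p / real q = of_int p' / of_int q'"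
    then obtain p' q' :: int where *: "even p'" "odd q'"
      "real_of_int p / real q = of_int p' / of_int q'" by blast
    have "q' \<noteq> 0" using *(2) by auto
    with *(3) q0 have "real_of_int (p * q') = real_of_int (p' * int q)"
      by (simp add: field_simps)
    hence "p * q' = p' * int q" by (simp only: of_int_eq_iff)
    with * show "even p" by (metis even_mult_iff)
  next
    assume "even p"
    moreover have "odd (int q)" using assms(2) by simp
    ultimately show "\<exists>p' q' :: int. even p' \<and> odd q' \<and> real_of_int p / real q = of_int p' / of_int q'"
      by (intro exI[of _ p] exI[of _ "int q"]) auto
  qed
  define y where "y = root q (- x)"
  have y: "y > 0" using assms(1) q0 by (simp add: y_def)
  have rx: "root q x = - y" by (simp add: y_def real_root_minus)
  have "(- x) powr (real_of_int p / real q) = ((- x) powr (1 / real q)) powr real_of_int p"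
    by (simp add: powr_powr)
  also have "(- x) powr (1 / real q) = y"
    using assms(1) q0 by (simp add: y_def root_powr_inverse)
  also have "y powr real_of_int p = y powi p"
    using y by (simp add: powr_real_of_int')
  finally have main: "(- x) powr (real_of_int p / real q) = y powi p" .
  have "(- y) powi p = (if even p then y powi p else - (y powi p))"
    by (simp add: power_int_minus_left)
  thus ?thesis
    unfolding rpow_def using par assms(1) main rx by simp
qed


section \<open>Smooth surfaces in space\<close>

text \<open>
  Maps of class $C^k$ on an open set, in terms of iterated directional derivatives.
\<close>

primrec C_on ::
  "nat \<Rightarrow> 'a::real_normed_vector set \<Rightarrow> ('a \<Rightarrow> 'b::real_normed_vector) \<Rightarrow> bool" where
  "C_on 0 S f \<longleftrightarrow> continuous_on S f"
| "C_on (Suc k) S f \<longleftrightarrow>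
     (\<forall>x\<in>S. f differentiable (at x)) \<and> (\<forall>v. C_on k S (\<lambda>x. frechet_derivative f (at x) v))"

definition smooth_on ::
  "'a::real_normed_vector set \<Rightarrow> ('a \<Rightarrow> 'b::real_normed_vector) \<Rightarrow> bool" where
  "smooth_on S f \<longleftrightarrow> (\<forall>k. C_on k S f)"

definition D1 :: "(real \<times> real \<Rightarrow> real^3) \<Rightarrow> real \<times> real \<Rightarrow> real^3" where
  "D1 X u = frechet_derivative X (at u) (1, 0)"

definition D2 :: "(real \<times> real \<Rightarrow> real^3) \<Rightarrow> real \<times> real \<Rightarrow> real^3" where
  "D2 X u = frechet_derivative X (at u) (0, 1)"

definition local_parametrization ::
  "(real^3) set \<Rightarrow> (real \<times> real) set \<Rightarrow> (real \<times> real \<Rightarrow> real^3) \<Rightarrow> bool" where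
  "local_parametrization \<Sigma> D X \<longleftrightarrow>
     open D \<and> smooth_on D X \<and>
     (\<forall>u\<in>D. cross3 (D1 X u) (D2 X u) \<noteq> 0) \<and>
     openin (top_of_set \<Sigma>) (X ` D) \<and>
     (\<exists>Y. homeomorphism D (X ` D) X Y)"

definition smooth_surface :: "(real^3) set \<Rightarrow> bool" where
  "smooth_surface \<Sigma> \<longleftrightarrow> (\<forall>p\<in>\<Sigma>. \<exists>D X. local_parametrization \<Sigma> D X \<and> p \<in> X ` D)"

definition is_unit_normal :: "(real^3) set \<Rightarrow> (real^3 \<Rightarrow> real^3) \<Rightarrow> bool" where
  "is_unit_normal \<Sigma> N \<longleftrightarrow>
     continuous_on \<Sigma> N \<and> (\<forall>p\<in>\<Sigma>. norm (N p) = 1) \<and>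
     (\<forall>D X. local_parametrization \<Sigma> D X \<longrightarrow>
        (\<forall>u\<in>D. N (X u) \<bullet> D1 X u = 0 \<and> N (X u) \<bullet> D2 X u = 0))"

text \<open>
  The Gauss curvature of a parametrization is the quotient of the determinants of the second
  and the first fundamental forms.
\<close>

definition param_normal :: "(real \<times> real \<Rightarrow> real^3) \<Rightarrow> real \<times> real \<Rightarrow> real^3" where
  "param_normal X u =
     cross3 (D1 X u) (D2 X u) /\<^sub>R norm (cross3 (D1 X u) (D2 X u))"

definition param_gauss_curvature :: "(real \<times> real \<Rightarrow> real^3) \<Rightarrow> real \<times> real \<Rightarrow> real" where
  "param_gauss_curvature X u =
     ((D1 (D1 X) u \<bullet> param_normal X u) * (D2 (D2 X) u \<bullet> param_normal X u)
        - (D2 (D1 X) u \<bullet> param_normal X u)\<^sup>2) /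
     ((D1 X u \<bullet> D1 X u) * (D2 X u \<bullet> D2 X u) - (D1 X u \<bullet> D2 X u)\<^sup>2)"

text \<open>
  The curvature does not depend on the local parametrization, so on a smooth surface exactly
  one function on \<open>\<Sigma>\<close> has the following property.
\<close>

definition is_gauss_curvature :: "(real^3) set \<Rightarrow> (real^3 \<Rightarrow> real) \<Rightarrow> bool" where
  "is_gauss_curvature \<Sigma> K \<longleftrightarrow>
     (\<forall>D X. local_parametrization \<Sigma> D X \<longrightarrow> (\<forall>u\<in>D. K (X u) = param_gauss_curvature X u))"

definition constant_gauss_curvature :: "(real^3) set \<Rightarrow> bool" where
  "constant_gauss_curvature \<Sigma> \<longleftrightarrow> (\<exists>c. is_gauss_curvature \<Sigma> (\<lambda>_. c))"

definition K_translator :: "real \<Rightarrow> real^3 \<Rightarrow> (real^3) set \<Rightarrow> bool" where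
  "K_translator \<alpha> v \<Sigma> \<longleftrightarrow>
     smooth_surface \<Sigma> \<and>
     (\<exists>N K. is_unit_normal \<Sigma> N \<and> is_gauss_curvature \<Sigma> K \<and>
        (\<forall>p\<in>\<Sigma>. rpow_defined (K p) \<alpha> \<and> rpow (K p) \<alpha> = N p \<bullet> v))"


section \<open>Helicoidal surfaces and Bour coordinates\<close>

definition helicoidal_param :: "real \<Rightarrow> (real \<Rightarrow> real) \<Rightarrow> real \<times> real \<Rightarrow> real^3" where
  "helicoidal_param h f = (\<lambda>(r, \<theta>). vector [r * cos \<theta>, r * sin \<theta>, f r + h * \<theta>])"



definition helicoidal_surface ::
  "real \<Rightarrow> real set \<Rightarrow> (real \<Rightarrow> real) \<Rightarrow> (real^3) set \<Rightarrow> bool" where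
  "helicoidal_surface h I f \<Sigma> \<longleftrightarrow>
     open I \<and> is_interval I \<and> I \<noteq> {} \<and> I \<subseteq> {0<..} \<and> smooth_on I f \<and>
     \<Sigma> = helicoidal_param h f ` (I \<times> UNIV)"

definition helicoidal_motion :: "real \<Rightarrow> real \<Rightarrow> real^3 \<Rightarrow> real^3" where
  "helicoidal_motion h \<phi> p =
     vector [p$1 * cos \<phi> - p$2 * sin \<phi>, p$1 * sin \<phi> + p$2 * cos \<phi>, p$3 + h * \<phi>]"

lemma helicoidal_surface_invariant:
  assumes "helicoidal_surface h I f \<Sigma>"
  shows "helicoidal_motion h \<phi> ` \<Sigma> = \<Sigma>"
proof -
  have *: "helicoidal_motion h \<phi> (helicoidal_param h f (r, \<theta>)) = helicoidal_param h f (r, \<theta> + \<phi>)"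
    for \<phi> r \<theta>
    by (simp add: helicoidal_motion_def helicoidal_param_def cos_add sin_add algebra_simps)
  have \<Sigma>: "\<Sigma> = helicoidal_param h f ` (I \<times> UNIV)"
    using assms by (simp add: helicoidal_surface_def)
  show ?thesis
  proof
    show "helicoidal_motion h \<phi> ` \<Sigma> \<subseteq> \<Sigma>"
      unfolding \<Sigma> using * by auto
    show "\<Sigma> \<subseteq> helicoidal_motion h \<phi> ` \<Sigma>"
    proof
      fix p assume "p \<in> \<Sigma>"
      then obtain r \<theta> where r: "r \<in> I" "p = helicoidal_param h f (r, \<theta>)"
        unfolding \<Sigma> by auto
      have "p = helicoidal_motion h \<phi> (helicoidal_param h f (r, \<theta> - \<phi>))"
        by (simp add: * r)
      thus "p \<in> helicoidal_motion h \<phi> ` \<Sigma>"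
        unfolding \<Sigma> using r(1) by blast
    qed
  qed
qed

definition bour_function :: "real \<Rightarrow> real \<Rightarrow> real" where
  "bour_function h r = sqrt (r\<^sup>2 + h\<^sup>2)"

text \<open>
  The angular Bour coordinate is $t = \theta + \Theta$, where $\Theta$, as a function of $r$,
  is determined up to an additive constant.
\<close>

definition is_bour_angle ::
  "real \<Rightarrow> real set \<Rightarrow> (real \<Rightarrow> real) \<Rightarrow> (real \<Rightarrow> real) \<Rightarrow> bool" where
  "is_bour_angle h I f \<Theta> \<longleftrightarrow>
     (\<forall>r\<in>I. (\<Theta> has_real_derivative h / (r\<^sup>2 + h\<^sup>2) * deriv f r) (at r))"

text \<open>
  The parametrization in the coordinates \<open>(U, t)\<close>; here \<open>F\<close> and \<open>\<Theta>\<close> are the profile function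
  and the angle as functions of \<open>U\<close>.
\<close>

definition bour_param ::
  "real \<Rightarrow> (real \<Rightarrow> real) \<Rightarrow> (real \<Rightarrow> real) \<Rightarrow> real \<times> real \<Rightarrow> real^3" where
  "bour_param h F \<Theta> = (\<lambda>(U, t).
     vector [sqrt (U\<^sup>2 - h\<^sup>2) * cos (t - \<Theta> U),
             sqrt (U\<^sup>2 - h\<^sup>2) * sin (t - \<Theta> U),
             F U + h * (t - \<Theta> U)])"

end

theory Submission
  imports Defs
begin

text \<open>
  Why the theorem holds. Let $\nu = \langle N, \vec v\rangle$ be the vertical component of the
  unit normal and write $p = f'(r)$. On a helicoidal surface both $\nu^2$ and $K$ depend on $r$
  alone: $\nu^2 = r^2 / (r^2 + h^2 + r^2 p^2)$ (\<open>vertical_component_normal\<close>) and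
  $K = (r^3 p p' - h^2) / (r^2 + h^2 + r^2 p^2)^2$ (\<open>gauss_curvature_helicoidal\<close>). The whole
  proof rests on the identity
  $$K = - \frac{d(\nu^2)}{d(U^2)}, \qquad U^2 = r^2 + h^2,$$
  which is \<open>normal_square_has_derivative\<close>. With $\varphi = \nu^2$ the translator equation
  $K^\alpha = \nu$ turns into the separable equation
  $d\varphi / d(U^2) = \mp \varphi^{1/(2\alpha)}$, and its integral (\<open>translator_ode_solution\<close>) is
  $\varphi = m^2 e^{-U^2}$ if $\alpha = 1/2$ and otherwise
  $\pm \varphi^{(2\alpha-1)/(2\alpha)} = m - \frac{2\alpha-1}{2\alpha} U^2$. The sign is that of
  $K$. It is the same on the whole surface because $\nu \ne 0$ forces $K \ne 0$. If $K < 0$, then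
  $\alpha = p/q$ with $q$ odd, which excludes $\alpha = 1/2$ and makes the exponents of the final
  formula fractions with odd denominator $2p - q$, the first with even numerator; so the powers of
  the negative number $m - \frac{2\alpha-1}{2\alpha} U^2$ are defined, and the first one is
  $\varphi$ itself, with the right sign.

  Finally $\nu^2$ determines $p^2$, and $dU = (r/U)\,dr$ turns $|p|$ into the stated $dF/dU$
  (\<open>profile_derivative_formula\<close>).

  The parametrization statement is the change of parameters $r = \sqrt{U^2 - h^2}$,
  $\theta = t - \Theta$ in the standard one (\<open>helicoidal_reparametrization\<close>). That the new one
  is smooth requires the closure of the classes $C^k$ under products and under composition, and the
  existence of $\Theta$ requires an antiderivative on an open interval.
\<close>

section \<open>Calculus of maps of class $C^k$\<close>

text \<open>
  The library derivative is a total function, so a map that is known on the open set only can be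
  replaced there without changing its iterated derivatives. This lets the derivative be computed by
  the usual rules, as in \<open>C_on_SucI\<close>.
\<close>

lemma C_on_cong:
  assumes "open S" "C_on k S f" "\<And>x. x \<in> S \<Longrightarrow> f x = g x"
  shows "C_on k S g"
  using assms(2,3)
proof (induction k arbitrary: f g)
  case 0
  thus ?case by (simp cong: continuous_on_cong)
next
  case (Suc k)
  have der: "(g has_derivative frechet_derivative f (at x)) (at x)" if "x \<in> S" for x
  proof (rule has_derivative_transform_within_open[OF _ assms(1) that])
    show "(f has_derivative frechet_derivative f (at x)) (at x)"
      using Suc.prems(1) that by (simp add: frechet_derivative_works)
  qed (rule Suc.prems(2))
  show ?case
    unfolding C_on.simps
  proof (intro conjI ballI allI)
    show "g differentiable (at x)" if "x \<in> S" for x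
      using der[OF that] by (auto simp: differentiable_def)
    show "C_on k S (\<lambda>x. frechet_derivative g (at x) v)" for v
    proof (rule Suc.IH)
      show "C_on k S (\<lambda>x. frechet_derivative f (at x) v)"
        using Suc.prems(1) by simp
      show "frechet_derivative f (at x) v = frechet_derivative g (at x) v" if "x \<in> S" for x
        using frechet_derivative_at[OF der[OF that]] by simp
    qed
  qed
qed

lemma C_on_SucI:
  assumes "open S" "\<And>x. x \<in> S \<Longrightarrow> (f has_derivative f' x) (at x)"
    and "\<And>v. C_on k S (\<lambda>x. f' x v)"
  shows "C_on (Suc k) S f"
  unfolding C_on.simps
proof (intro conjI ballI allI)
  show "f differentiable (at x)" if "x \<in> S" for x
    using assms(2)[OF that] by (auto simp: differentiable_def)
  show "C_on k S (\<lambda>x. frechet_derivative f (at x) v)" for v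
    using assms(3)[of v]
    by (rule C_on_cong[OF assms(1)]) (simp add: frechet_derivative_at[OF assms(2), symmetric])
qed

lemma C_on_Suc_has_derivative:
  assumes "C_on (Suc k) S f" "x \<in> S"
  shows "(f has_derivative frechet_derivative f (at x)) (at x)"
  using assms by (simp add: frechet_derivative_works)

lemma C_on_SucD: "C_on (Suc k) S f \<Longrightarrow> C_on k S f"
proof (induction k arbitrary: f)
  case 0
  thus ?case
    by (auto intro!: continuous_at_imp_continuous_on differentiable_imp_continuous_within)
next
  case (Suc k)
  thus ?case by simp
qed

lemma C_on_const: "open S \<Longrightarrow> C_on k S (\<lambda>_. c)"
proof (induction k arbitrary: c)
  case (Suc k)
  show ?case
    by (rule C_on_SucI[where f' = "\<lambda>_ _. 0"]) (auto intro: Suc)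
qed simp

lemma C_on_bounded_linear:
  assumes "open S" "bounded_linear f"
  shows "C_on k S f"
proof (cases k)
  case 0
  thus ?thesis using assms by (simp add: linear_continuous_on)
next
  case (Suc n)
  have "C_on (Suc n) S f"
    by (rule C_on_SucI[where f' = "\<lambda>_. f"])
       (auto intro: assms C_on_const bounded_linear_imp_has_derivative)
  thus ?thesis by (simp add: Suc)
qed

lemma C_on_add:
  assumes "open S" "C_on k S f" "C_on k S g"
  shows "C_on k S (\<lambda>x. f x + g x)"
  using assms(2,3)
proof (induction k arbitrary: f g)
  case 0
  thus ?case by (auto intro: continuous_on_add)
next
  case (Suc k)
  show ?case
  proof (rule C_on_SucI[OF assms(1)])
    show "((\<lambda>x. f x + g x) has_derivative
        (\<lambda>v. frechet_derivative f (at x) v + frechet_derivative g (at x) v)) (at x)"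
      if "x \<in> S" for x
      using Suc.prems that by (intro has_derivative_add C_on_Suc_has_derivative)
    show "C_on k S (\<lambda>x. frechet_derivative f (at x) v + frechet_derivative g (at x) v)" for v
      using Suc.prems by (intro Suc.IH) simp_all
  qed
qed

lemma C_on_scaleR:
  assumes "open S" "C_on k S f" "C_on k S g"
  shows "C_on k S (\<lambda>x. f x *\<^sub>R g x)"
  using assms(2,3)
proof (induction k arbitrary: f g)
  case 0
  thus ?case by (auto intro: continuous_on_scaleR)
next
  case (Suc k)
  show ?case
  proof (rule C_on_SucI[OF assms(1)])
    show "((\<lambda>x. f x *\<^sub>R g x) has_derivative
        (\<lambda>v. f x *\<^sub>R frechet_derivative g (at x) v + frechet_derivative f (at x) v *\<^sub>R g x)) (at x)"
      if "x \<in> S" for x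
      using Suc.prems that by (intro has_derivative_scaleR C_on_Suc_has_derivative)
    show "C_on k S (\<lambda>x. f x *\<^sub>R frechet_derivative g (at x) v
            + frechet_derivative f (at x) v *\<^sub>R g x)" for v
      using Suc.prems C_on_SucD[OF Suc.prems(1)] C_on_SucD[OF Suc.prems(2)]
      by (intro C_on_add[OF assms(1)] Suc.IH) simp_all
  qed
qed

text \<open>
  Since the inner function is real-valued, the derivative of the composition is the product of
  $Df(x)(v)$ with the single vector $g'(f(x))$; the induction then needs products only, and not the
  composition of a linear map with a varying linear map.
\<close>

lemma C_on_compose:
  fixes g :: "real \<Rightarrow> 'b::real_normed_vector" and f :: "'a::real_normed_vector \<Rightarrow> real"
  assumes "open S" "C_on k T g" "C_on k S f" "f ` S \<subseteq> T"
  shows "C_on k S (\<lambda>x. g (f x))"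
  using assms(2,3)
proof (induction k arbitrary: g)
  case 0
  thus ?case using assms(4) by (auto intro: continuous_on_compose2)
next
  case (Suc k)
  let ?g' = "\<lambda>y. frechet_derivative g (at y) 1"
  show ?case
  proof (rule C_on_SucI[OF assms(1)])
    show "((\<lambda>x. g (f x)) has_derivative
        (\<lambda>v. frechet_derivative f (at x) v *\<^sub>R ?g' (f x))) (at x)" if "x \<in> S" for x
    proof -
      have fx: "f x \<in> T" using that assms(4) by blast
      note g' = C_on_Suc_has_derivative[OF Suc.prems(1) fx]
      have "frechet_derivative g (at (f x)) = (\<lambda>d. d *\<^sub>R ?g' (f x))"
      proof
        show "frechet_derivative g (at (f x)) d = d *\<^sub>R ?g' (f x)" for d
          using linear_scale[OF has_derivative_linear[OF g'], of d 1] by simp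
      qed
      with g' have "(g has_derivative (\<lambda>d. d *\<^sub>R ?g' (f x))) (at (f x))"
        by metis
      from diff_chain_at[OF C_on_Suc_has_derivative[OF Suc.prems(2) that] this]
      show ?thesis unfolding o_def .
    qed
    show "C_on k S (\<lambda>x. frechet_derivative f (at x) v *\<^sub>R ?g' (f x))" for v
      using Suc.prems C_on_SucD[OF Suc.prems(2)]
      by (intro C_on_scaleR[OF assms(1)] Suc.IH) simp_all
  qed
qed

lemma smooth_on_const: "open S \<Longrightarrow> smooth_on S (\<lambda>_. c)"
  by (simp add: smooth_on_def C_on_const)

lemma smooth_on_bounded_linear: "open S \<Longrightarrow> bounded_linear f \<Longrightarrow> smooth_on S f"
  by (simp add: smooth_on_def C_on_bounded_linear)

lemma smooth_on_add:
  "open S \<Longrightarrow> smooth_on S f \<Longrightarrow> smooth_on S g \<Longrightarrow> smooth_on S (\<lambda>x. f x + g x)"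
  by (simp add: smooth_on_def C_on_add)

lemma smooth_on_scaleR:
  "open S \<Longrightarrow> smooth_on S f \<Longrightarrow> smooth_on S g \<Longrightarrow> smooth_on S (\<lambda>x. f x *\<^sub>R g x)"
  by (simp add: smooth_on_def C_on_scaleR)

lemma smooth_on_mult:
  fixes f g :: "'a::real_normed_vector \<Rightarrow> real"
  shows "open S \<Longrightarrow> smooth_on S f \<Longrightarrow> smooth_on S g \<Longrightarrow> smooth_on S (\<lambda>x. f x * g x)"
  using smooth_on_scaleR[of S f g] by simp

lemma smooth_on_diff:
  fixes f g :: "'a::real_normed_vector \<Rightarrow> real"
  assumes "open S" "smooth_on S f" "smooth_on S g"
  shows "smooth_on S (\<lambda>x. f x - g x)"
  using smooth_on_add[OF assms(1,2)
      smooth_on_scaleR[OF assms(1) smooth_on_const[OF assms(1), where c = "-1"] assms(3)]] by simp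

lemma smooth_on_compose:
  fixes g :: "real \<Rightarrow> 'b::real_normed_vector" and f :: "'a::real_normed_vector \<Rightarrow> real"
  assumes "open S" "smooth_on T g" "smooth_on S f" "f ` S \<subseteq> T"
  shows "smooth_on S (\<lambda>x. g (f x))"
  using assms by (simp add: smooth_on_def C_on_compose[of S _ T g f])

lemma smooth_on_vector3:
  fixes a b c :: "'a::real_normed_vector \<Rightarrow> real"
  assumes "open S" "smooth_on S a" "smooth_on S b" "smooth_on S c"
  shows "smooth_on S (\<lambda>x. vector [a x, b x, c x] :: real^3)"
proof -
  have "smooth_on S (\<lambda>x. a x *\<^sub>R (vector [1,0,0] :: real^3) + b x *\<^sub>R vector [0,1,0]
      + c x *\<^sub>R vector [0,0,1])"
    using assms by (intro smooth_on_add smooth_on_scaleR smooth_on_const)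
  also have "(\<lambda>x. a x *\<^sub>R (vector [1,0,0] :: real^3) + b x *\<^sub>R vector [0,1,0]
      + c x *\<^sub>R vector [0,0,1]) = (\<lambda>x. vector [a x, b x, c x])"
    by (simp add: fun_eq_iff vec_eq_iff forall_3)
  finally show ?thesis .
qed

lemma C_on_Suc_realI:
  fixes f :: "real \<Rightarrow> real"
  assumes "open S" "\<And>x. x \<in> S \<Longrightarrow> (f has_real_derivative f' x) (at x)" "C_on k S f'"
  shows "C_on (Suc k) S f"
proof (rule C_on_SucI[OF assms(1)])
  show "(f has_derivative (\<lambda>v. f' x * v)) (at x)" if "x \<in> S" for x
    using assms(2)[OF that] by (simp add: has_field_derivative_def)
  show "C_on k S (\<lambda>x. f' x * v)" for v
    using C_on_scaleR[OF assms(1,3) C_on_const[OF assms(1)], of v] by simp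
qed

text \<open>
  In particular an antiderivative of a smooth function is smooth, which gives the smoothness of the
  Bour angle.
\<close>

lemma smooth_on_realI:
  fixes f :: "real \<Rightarrow> real"
  assumes "open S" "\<And>x. x \<in> S \<Longrightarrow> (f has_real_derivative f' x) (at x)" "smooth_on S f'"
  shows "smooth_on S f"
  unfolding smooth_on_def
proof
  show "C_on k S f" for k
    by (rule C_on_SucD, rule C_on_Suc_realI[OF assms(1,2)])
       (use assms(3) in \<open>simp_all add: smooth_on_def\<close>)
qed

lemma smooth_on_real_deriv:
  fixes f :: "real \<Rightarrow> real"
  assumes "open S" "smooth_on S f"
  shows "smooth_on S (deriv f)"
    and "x \<in> S \<Longrightarrow> (f has_real_derivative deriv f x) (at x)"
proof -
  have diff: "f differentiable (at x)" if "x \<in> S" for x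
    using assms(2) that C_on.simps(2)[of 0 S f] unfolding smooth_on_def by blast
  have eq: "frechet_derivative f (at x) 1 = deriv f x" and
    der: "(f has_real_derivative deriv f x) (at x)" if "x \<in> S" for x
  proof -
    show der: "(f has_real_derivative deriv f x) (at x)"
      using diff[OF that] by (simp add: DERIV_deriv_iff_real_differentiable)
    show "frechet_derivative f (at x) 1 = deriv f x"
      using frechet_derivative_at[OF der[unfolded has_field_derivative_def]] by (metis mult.right_neutral)
  qed
  show "x \<in> S \<Longrightarrow> (f has_real_derivative deriv f x) (at x)" by (rule der)
  show "smooth_on S (deriv f)"
    unfolding smooth_on_def
  proof
    fix k
    have "C_on (Suc k) S f" using assms(2) unfolding smooth_on_def by blast
    hence "C_on k S (\<lambda>x. frechet_derivative f (at x) 1)" by simp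
    thus "C_on k S (deriv f)" by (rule C_on_cong[OF assms(1)]) (simp add: eq)
  qed
qed

text \<open>
  All exponents are treated at once, because differentiation lowers the exponent.
\<close>

lemma smooth_on_powr: "smooth_on {0<..} (\<lambda>x :: real. x powr a)"
  unfolding smooth_on_def
proof
  show "C_on k {0<..} (\<lambda>x :: real. x powr a)" for k
  proof (induction k arbitrary: a)
    case 0
    show ?case by (auto intro!: continuous_intros)
  next
    case (Suc k)
    show ?case
    proof (rule C_on_Suc_realI)
      show "((\<lambda>x. x powr a) has_real_derivative a * x powr (a - 1)) (at x)"
        if "x \<in> {0<..}" for x
        using that by (auto intro!: derivative_eq_intros)
      show "C_on k {0<..} (\<lambda>x. a * x powr (a - 1))"
        using C_on_scaleR[OF _ C_on_const Suc.IH, of a "a - 1"] by simp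
    qed simp
  qed
qed

lemma smooth_on_cong:
  "open S \<Longrightarrow> smooth_on S f \<Longrightarrow> (\<And>x. x \<in> S \<Longrightarrow> f x = g x) \<Longrightarrow> smooth_on S g"
  unfolding smooth_on_def using C_on_cong by blast

lemma smooth_on_sqrt: "smooth_on {0<..} sqrt"
  by (rule smooth_on_cong[OF _ smooth_on_powr[of "1/2"]]) (auto simp: powr_half_sqrt)

lemma C_on_sin_cos: "C_on k UNIV (sin :: real \<Rightarrow> real) \<and> C_on k UNIV (cos :: real \<Rightarrow> real)"
proof (induction k)
  case 0
  show ?case by (auto intro: continuous_intros)
next
  case (Suc k)
  have "C_on k UNIV (\<lambda>x :: real. - sin x)"
    using C_on_scaleR[of UNIV k "\<lambda>_. -1" "sin :: real \<Rightarrow> real"] C_on_const[of "UNIV :: real set" k "-1 :: real"] Suc by simp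
  thus ?case
    using Suc C_on_Suc_realI[of UNIV sin cos k] C_on_Suc_realI[of UNIV cos "\<lambda>x. - sin x" k]
    by (auto simp del: C_on.simps intro!: derivative_eq_intros)
qed

lemma smooth_on_sin_cos:
  "smooth_on UNIV (sin :: real \<Rightarrow> real)" "smooth_on UNIV (cos :: real \<Rightarrow> real)"
  by (simp_all add: smooth_on_def C_on_sin_cos)

text \<open>
  The infimum and the supremum of the interval, taken in the extended reals, turn it into the form
  in which the fundamental theorem of calculus for improper intervals applies.
\<close>

lemma antiderivative_open_interval:
  fixes g :: "real \<Rightarrow> real"
  assumes "open I" "is_interval I" "I \<noteq> {}" "continuous_on I g"
  obtains G where "\<And>x. x \<in> I \<Longrightarrow> (G has_real_derivative g x) (at x)"
proof -
  define a b where "a = Inf (ereal ` I)" and "b = Sup (ereal ` I)"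
  have ab: "a < ereal x \<and> ereal x < b" if x: "x \<in> I" for x
  proof -
    obtain e where e: "e > 0" "cball x e \<subseteq> I"
      using assms(1) x unfolding open_contains_cball by blast
    have "x - e \<in> I" "x + e \<in> I" using e by (auto simp: cball_eq_atLeastAtMost)
    hence "a \<le> ereal (x - e)" "ereal (x + e) \<le> b"
      unfolding a_def b_def by (auto intro: Inf_lower Sup_upper)
    moreover have "ereal (x - e) < ereal x" "ereal x < ereal (x + e)" using e(1) by auto
    ultimately show ?thesis by (metis order_le_less_trans order_less_le_trans)
  qed
  have inI: "x \<in> I" if x: "a < ereal x" "ereal x < b" for x
  proof -
    obtain y where "y \<in> I" "y < x"
      using x(1) unfolding a_def Inf_less_iff by auto
    moreover obtain z where "z \<in> I" "x < z"
      using x(2) unfolding b_def less_Sup_iff by auto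
    ultimately show ?thesis using assms(2) unfolding is_interval_1 by (metis less_imp_le)
  qed
  obtain x0 where "x0 \<in> I" using assms(3) by blast
  hence "a < b" using ab by (metis order_less_trans)
  then obtain G where "\<forall>x :: real. a < x \<longrightarrow> x < b \<longrightarrow> (G has_vector_derivative g x) (at x)"
    using einterval_antiderivative[of a b g] inI assms(1,4)
    by (metis continuous_on_eq_continuous_at)
  thus ?thesis
    using ab by (intro that[of G]) (simp add: has_real_derivative_iff_has_vector_derivative)
qed

section \<open>Geometry of a helicoidal surface\<close>

text \<open>
  The coordinate tangent vectors of the parametrization by \<open>(r, \<theta>)\<close>, where \<open>p\<close> stands for
  the slope \<open>f'(r)\<close> of the profile.
\<close>

definition tangent_r :: "real \<Rightarrow> real \<Rightarrow> real^3" where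
  "tangent_r p \<theta> = vector [cos \<theta>, sin \<theta>, p]"

definition tangent_\<theta> :: "real \<Rightarrow> real \<Rightarrow> real \<Rightarrow> real^3" where
  "tangent_\<theta> h r \<theta> = vector [- (r * sin \<theta>), r * cos \<theta>, h]"

lemma has_derivative_vector3:
  assumes "(a has_derivative a') F" "(b has_derivative b') F" "(c has_derivative c') F"
  shows "((\<lambda>x. vector [a x, b x, c x] :: real^3) has_derivative
           (\<lambda>v. vector [a' v, b' v, c' v])) F"
proof -
  have eq: "(\<lambda>x. vector [a x, b x, c x] :: real^3) =
    (\<lambda>x. a x *\<^sub>R vector [1,0,0] + b x *\<^sub>R vector [0,1,0] + c x *\<^sub>R vector [0,0,1])"
    for a b c :: "'x \<Rightarrow> real"
    by (simp add: fun_eq_iff vec_eq_iff forall_3)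
  show ?thesis
    unfolding eq using assms by (intro has_derivative_add has_derivative_scaleR_left)
qed

lemma has_derivative_fst_compose:
  assumes "(g has_real_derivative d) (at r)"
  shows "((\<lambda>u :: real \<times> real. g (fst u)) has_derivative (\<lambda>v. d * fst v)) (at (r, \<theta>))"
  using DERIV_compose_FDERIV[of g d fst "(r, \<theta>)" fst UNIV] assms
  by (simp add: bounded_linear_imp_has_derivative bounded_linear_fst mult.commute)

text \<open>
  The chain rule for an arbitrary change of the parameters \<open>(r, \<theta>) = (a, b)\<close>; both the standard
  parametrization and the one in Bour coordinates are instances.
\<close>

lemma helicoidal_param_chain:
  assumes "(a has_derivative a') (at u)" "(b has_derivative b') (at u)"
    and "(f has_real_derivative p) (at (a u))"
  shows "((\<lambda>u. helicoidal_param h f (a u, b u)) has_derivative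
    (\<lambda>v. a' v *\<^sub>R tangent_r p (b u) + b' v *\<^sub>R tangent_\<theta> h (a u) (b u))) (at u)"
proof -
  have f: "((\<lambda>u. f (a u)) has_derivative (\<lambda>v. p * a' v)) (at u)"
    using diff_chain_at[OF assms(1) assms(3)[unfolded has_field_derivative_def]]
    by (simp add: o_def)
  have "((\<lambda>u. vector [a u * cos (b u), a u * sin (b u), f (a u) + h * b u] :: real^3)
    has_derivative (\<lambda>v. vector [a u * (b' v * (- sin (b u))) + a' v * cos (b u),
      a u * (b' v * cos (b u)) + a' v * sin (b u), p * a' v + h * b' v])) (at u)"
    by (intro has_derivative_vector3 has_derivative_mult has_derivative_add
        DERIV_compose_FDERIV[OF DERIV_cos] DERIV_compose_FDERIV[OF DERIV_sin]
        has_derivative_mult_right assms f)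
  moreover have "(\<lambda>v. vector [a u * (b' v * (- sin (b u))) + a' v * cos (b u),
      a u * (b' v * cos (b u)) + a' v * sin (b u), p * a' v + h * b' v] :: real^3)
    = (\<lambda>v. a' v *\<^sub>R tangent_r p (b u) + b' v *\<^sub>R tangent_\<theta> h (a u) (b u))"
    by (simp add: fun_eq_iff vec_eq_iff forall_3 tangent_r_def tangent_\<theta>_def algebra_simps)
  ultimately show ?thesis
    by (simp add: helicoidal_param_def)
qed

lemma cross_tangents:
  "cross3 (tangent_r p \<theta>) (tangent_\<theta> h r \<theta>) =
     vector [h * sin \<theta> - p * r * cos \<theta>, - (h * cos \<theta>) - p * r * sin \<theta>, r]"
proof -
  have "(sin \<theta>)\<^sup>2 + (cos \<theta>)\<^sup>2 = 1" by simp
  hence "r * cos \<theta> * cos \<theta> + r * sin \<theta> * sin \<theta> = r"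
    by algebra
  thus ?thesis
    by (simp add: cross3_def vec_eq_iff forall_3 tangent_r_def tangent_\<theta>_def ac_simps)
qed

lemma norm_cross_tangents:
  "(norm (cross3 (tangent_r p \<theta>) (tangent_\<theta> h r \<theta>)))\<^sup>2 = r\<^sup>2 + h\<^sup>2 + r\<^sup>2 * p\<^sup>2"
proof -
  have "(norm (cross3 (tangent_r p \<theta>) (tangent_\<theta> h r \<theta>)))\<^sup>2 =
    (h\<^sup>2 + p\<^sup>2 * r\<^sup>2) * ((sin \<theta>)\<^sup>2 + (cos \<theta>)\<^sup>2) + r\<^sup>2"
    unfolding cross_tangents power2_norm_eq_inner inner_vec_def sum_3
    by (simp add: algebra_simps power2_eq_square
          del: sin_cos_squared_add sin_cos_squared_add2 sin_cos_squared_add3)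
  thus ?thesis by (simp add: algebra_simps)
qed

text \<open>
  The change of parameters $r = \rho(U)$, $\theta = t - T(U)$ has Jacobian determinant
  $\rho'(U) \ne 0$, so it multiplies the cross product of the tangent vectors by \<open>\<rho>'\<close>. The inverse
  is explicit: $r$ is the distance to the axis, and because $h \ne 0$ the height determines the
  angle itself and not just its class modulo $2\pi$. Taking for \<open>\<rho>\<close> the identity and \<open>T = 0\<close>
  gives the standard parametrization.
\<close>

lemma helicoidal_reparametrization:
  assumes surf: "helicoidal_surface h I f \<Sigma>" and h: "h \<noteq> 0"
    and J: "open J" and \<rho>: "homeomorphism J I \<rho> \<sigma>" "smooth_on J \<rho>"
    and \<rho>': "\<And>U. U \<in> J \<Longrightarrow> deriv \<rho> U \<noteq> 0" and T: "smooth_on J T"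
  defines "X \<equiv> \<lambda>(U, t). helicoidal_param h f (\<rho> U, t - T U)"
  shows "local_parametrization \<Sigma> (J \<times> UNIV) X" and "X ` (J \<times> UNIV) = \<Sigma>"
proof -
  note sd = surf[unfolded helicoidal_surface_def]
  have I: "open I" "I \<subseteq> {0<..}" and f: "smooth_on I f" and \<Sigma>: "\<Sigma> = helicoidal_param h f ` (I \<times> UNIV)"
    using sd by auto
  have D: "open (J \<times> (UNIV :: real set))" using J by (simp add: open_Times)
  let ?a = "\<lambda>u :: real \<times> real. \<rho> (fst u)" and ?b = "\<lambda>u :: real \<times> real. snd u - T (fst u)"
  have X: "X = (\<lambda>u. helicoidal_param h f (?a u, ?b u))"
    by (auto simp: X_def)
  have \<rho>I: "\<rho> U \<in> I" if "U \<in> J" for U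
    using \<rho>(1) that unfolding homeomorphism_def by blast
  have a: "smooth_on (J \<times> UNIV) ?a"
    by (rule smooth_on_compose[OF D \<rho>(2)]) (auto intro: smooth_on_bounded_linear D bounded_linear_fst)
  have b: "smooth_on (J \<times> UNIV) ?b"
    by (intro smooth_on_diff[OF D] smooth_on_compose[OF D T] smooth_on_bounded_linear[OF D]
        bounded_linear_fst bounded_linear_snd) auto
  have sm: "smooth_on (J \<times> UNIV) X"
    unfolding X helicoidal_param_def prod.case
    by (intro smooth_on_vector3 smooth_on_add smooth_on_mult smooth_on_const D a b
        smooth_on_compose[OF D smooth_on_sin_cos(1) b] smooth_on_compose[OF D smooth_on_sin_cos(2) b]
        smooth_on_compose[OF D f a]) (auto intro: \<rho>I)
  have der: "(X has_derivative (\<lambda>v. (deriv \<rho> U * fst v) *\<^sub>R tangent_r (deriv f (\<rho> U)) (t - T U)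
      + (snd v - deriv T U * fst v) *\<^sub>R tangent_\<theta> h (\<rho> U) (t - T U))) (at (U, t))"
    if U: "U \<in> J" for U t
  proof -
    have "(?a has_derivative (\<lambda>v. deriv \<rho> U * fst v)) (at (U, t))"
      by (rule has_derivative_fst_compose[OF smooth_on_real_deriv(2)[OF J \<rho>(2) U]])
    moreover have "((\<lambda>u. T (fst u)) has_derivative (\<lambda>v. deriv T U * fst v)) (at (U, t))"
      by (rule has_derivative_fst_compose[OF smooth_on_real_deriv(2)[OF J T U]])
    hence "(?b has_derivative (\<lambda>v. snd v - deriv T U * fst v)) (at (U, t))"
      by (intro has_derivative_diff bounded_linear_imp_has_derivative[OF bounded_linear_snd])
    ultimately show ?thesis
      using helicoidal_param_chain[of ?a _ "(U, t)" ?b _ f "deriv f (\<rho> U)" h]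
        smooth_on_real_deriv(2)[OF I(1) f \<rho>I[OF U]]
      by (simp add: X)
  qed
  have cross: "cross3 (D1 X u) (D2 X u) \<noteq> 0" if u: "u \<in> J \<times> UNIV" for u
  proof -
    obtain U t where U: "u = (U, t)" "U \<in> J" using u by auto
    let ?A = "tangent_r (deriv f (\<rho> U)) (t - T U)" and ?B = "tangent_\<theta> h (\<rho> U) (t - T U)"
    have "cross3 (D1 X u) (D2 X u) = deriv \<rho> U *\<^sub>R cross3 ?A ?B"
      unfolding D1_def D2_def U frechet_derivative_at[OF der[OF U(2)], symmetric]
      by (simp add: Cross3.left_diff_distrib cross_mult_left)
    moreover have "cross3 ?A ?B \<noteq> 0"
    proof
      assume "cross3 ?A ?B = 0"
      hence "r\<^sup>2 = 0" if "r = \<rho> U" for r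
        using cross_tangents[of "deriv f (\<rho> U)" "t - T U" h "\<rho> U"] that
        by (metis vector_3(3) zero_index zero_power2)
      thus False using \<rho>I[OF U(2)] I(2) by auto
    qed
    ultimately show ?thesis using \<rho>'[OF U(2)] by simp
  qed
  have \<sigma>: "\<sigma> r \<in> J" "\<rho> (\<sigma> r) = r" if "r \<in> I" for r
    using \<rho>(1) that unfolding homeomorphism_def by blast+
  have \<sigma>\<rho>: "\<sigma> (\<rho> U) = U" if "U \<in> J" for U
    using \<rho>(1) that unfolding homeomorphism_def by blast
  show img: "X ` (J \<times> UNIV) = \<Sigma>"
  proof
    show "X ` (J \<times> UNIV) \<subseteq> \<Sigma>" unfolding \<Sigma> X using \<rho>I by auto
    show "\<Sigma> \<subseteq> X ` (J \<times> UNIV)"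
    proof
      fix q assume "q \<in> \<Sigma>"
      then obtain r \<theta> where "r \<in> I" "q = helicoidal_param h f (r, \<theta>)" unfolding \<Sigma> by auto
      hence "q = X (\<sigma> r, \<theta> + T (\<sigma> r))" by (simp add: X \<sigma>)
      thus "q \<in> X ` (J \<times> UNIV)" using \<sigma>(1)[OF \<open>r \<in> I\<close>] by blast
    qed
  qed
  \<comment> \<open>The distance to the axis recovers \<open>r\<close>, and the height then recovers the angle.\<close>
  define R :: "real^3 \<Rightarrow> real" where "R p = sqrt ((p$1)\<^sup>2 + (p$2)\<^sup>2)" for p
  define Y where "Y p = (\<sigma> (R p), (p$3 - f (R p)) / h + T (\<sigma> (R p)))" for p
  have R: "R (helicoidal_param h f (r, \<theta>)) = r" if "r \<in> I" for r \<theta>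
  proof -
    have "(r * cos \<theta>)\<^sup>2 + (r * sin \<theta>)\<^sup>2 = r\<^sup>2 * ((sin \<theta>)\<^sup>2 + (cos \<theta>)\<^sup>2)"
      by (simp add: algebra_simps power_mult_distrib
          del: sin_cos_squared_add sin_cos_squared_add2 sin_cos_squared_add3)
    thus ?thesis using that I(2) by (auto simp: R_def helicoidal_param_def)
  qed
  have YX: "Y (X u) = u" if u: "u \<in> J \<times> UNIV" for u
  proof -
    obtain U t where U: "u = (U, t)" "U \<in> J" using u by auto
    have "X u $ 3 = f (\<rho> U) + h * (t - T U)" by (simp add: X U helicoidal_param_def)
    moreover have "R (X u) = \<rho> U" using R[OF \<rho>I[OF U(2)]] by (simp add: X U)
    ultimately show ?thesis using h U by (simp add: Y_def \<sigma>\<rho>)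
  qed
  have RI: "R ` \<Sigma> \<subseteq> I" unfolding \<Sigma> using R by auto
  have cf: "continuous_on I f" and cT: "continuous_on J T"
    using f T C_on.simps(1) unfolding smooth_on_def by blast+
  have cR: "continuous_on \<Sigma> R" unfolding R_def by (intro continuous_intros)
  have c\<sigma>: "continuous_on \<Sigma> (\<lambda>p. \<sigma> (R p))"
    using \<rho>(1) RI by (intro continuous_on_compose2[OF _ cR]) (auto simp: homeomorphism_def)
  have cY: "continuous_on \<Sigma> Y"
    unfolding Y_def using RI h \<sigma>(1)
    by (intro continuous_intros c\<sigma> continuous_on_compose2[OF cf cR] continuous_on_compose2[OF cT c\<sigma>]) auto
  have "homeomorphism (J \<times> UNIV) (X ` (J \<times> UNIV)) X Y"
  proof (rule homeomorphismI)
    show "continuous_on (J \<times> UNIV) X"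
      using sm C_on.simps(1) unfolding smooth_on_def by blast
    show "continuous_on (X ` (J \<times> UNIV)) Y" using cY by (simp add: img)
    show "X ` (J \<times> UNIV) \<subseteq> X ` (J \<times> UNIV)" ..
    show "Y ` X ` (J \<times> UNIV) \<subseteq> J \<times> UNIV" using YX by auto
    show "Y (X u) = u" if "u \<in> J \<times> UNIV" for u by (rule YX[OF that])
    show "X (Y y) = y" if "y \<in> X ` (J \<times> UNIV)" for y using YX that by auto
  qed
  thus "local_parametrization \<Sigma> (J \<times> UNIV) X"
    unfolding local_parametrization_def using D sm cross img by auto
qed

lemma
  assumes I: "open I" and f: "smooth_on I f" and r: "r \<in> I"
  shows D1_helicoidal: "D1 (helicoidal_param h f) (r, \<theta>) = tangent_r (deriv f r) \<theta>"
    and D2_helicoidal: "D2 (helicoidal_param h f) (r, \<theta>) = tangent_\<theta> h r \<theta>"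
proof -
  have "(helicoidal_param h f has_derivative
    (\<lambda>v. fst v *\<^sub>R tangent_r (deriv f r) \<theta> + snd v *\<^sub>R tangent_\<theta> h r \<theta>)) (at (r, \<theta>))"
    using helicoidal_param_chain[of fst fst "(r, \<theta>)" snd snd f "deriv f r" h]
      smooth_on_real_deriv(2)[OF I f r]
    by (simp add: bounded_linear_imp_has_derivative bounded_linear_fst bounded_linear_snd)
  from frechet_derivative_at[OF this, symmetric]
  show "D1 (helicoidal_param h f) (r, \<theta>) = tangent_r (deriv f r) \<theta>"
    and "D2 (helicoidal_param h f) (r, \<theta>) = tangent_\<theta> h r \<theta>"
    by (simp_all add: D1_def D2_def)
qed

text \<open>
  Second derivatives: the formulas for \<open>D1\<close> and \<open>D2\<close> hold on an open set, so they may be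
  differentiated there in place of the derivatives themselves.
\<close>

lemma D1_D2_eqI:
  assumes "open S" "u \<in> S" "\<And>v. v \<in> S \<Longrightarrow> X v = Z v" "(Z has_derivative Z') (at u)"
  shows "D1 X u = Z' (1, 0)" "D2 X u = Z' (0, 1)"
proof -
  have "(X has_derivative Z') (at u)"
    using has_derivative_transform_within_open[OF assms(4,1,2)] assms(3) by auto
  from frechet_derivative_at[OF this, symmetric]
  show "D1 X u = Z' (1, 0)" "D2 X u = Z' (0, 1)"
    by (simp_all add: D1_def D2_def)
qed

lemma gauss_curvature_helicoidal:
  assumes I: "open I" and f: "smooth_on I f" and r: "r \<in> I" "r > 0"
  shows "param_gauss_curvature (helicoidal_param h f) (r, \<theta>) =
    (r ^ 3 * deriv f r * deriv (deriv f) r - h\<^sup>2) / (r\<^sup>2 + h\<^sup>2 + r\<^sup>2 * (deriv f r)\<^sup>2)\<^sup>2"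
proof -
  let ?X = "helicoidal_param h f" and ?S = "I \<times> (UNIV :: real set)" and ?u = "(r, \<theta>)"
  let ?p = "deriv f r" and ?q = "deriv (deriv f) r"
  have S: "open ?S" "?u \<in> ?S" using I r by (auto intro: open_Times)
  let ?fst = "fst :: real \<times> real \<Rightarrow> real" and ?snd = "snd :: real \<times> real \<Rightarrow> real"
  have fst: "(?fst has_derivative fst) (at ?u)" and snd: "(?snd has_derivative snd) (at ?u)"
    by (auto intro: bounded_linear_imp_has_derivative bounded_linear_fst bounded_linear_snd)
  have p: "((\<lambda>u. deriv f (fst u)) has_derivative (\<lambda>v. ?q * fst v)) (at ?u)"
    by (rule has_derivative_fst_compose[OF
          smooth_on_real_deriv(2)[OF I smooth_on_real_deriv(1)[OF I f] r(1)]])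
  have "((\<lambda>u. vector [cos (snd u), sin (snd u), deriv f (fst u)] :: real^3) has_derivative
    (\<lambda>v. vector [snd v * (- sin (snd ?u)), snd v * cos (snd ?u), ?q * fst v])) (at ?u)"
    by (intro has_derivative_vector3 DERIV_compose_FDERIV[OF DERIV_cos]
        DERIV_compose_FDERIV[OF DERIV_sin] snd p)
  from D1_D2_eqI[OF S _ this, of "D1 ?X"]
  have X1: "D1 (D1 ?X) ?u = vector [0, 0, ?q]" "D2 (D1 ?X) ?u = vector [- sin \<theta>, cos \<theta>, 0]"
    using D1_helicoidal[OF I f] by (auto simp: tangent_r_def)
  have "((\<lambda>u. vector [fst u * - sin (snd u), fst u * cos (snd u), h] :: real^3) has_derivative
    (\<lambda>v. vector [fst ?u * - (snd v * cos (snd ?u)) + fst v * - sin (snd ?u),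
      fst ?u * (snd v * - sin (snd ?u)) + fst v * cos (snd ?u), 0])) (at ?u)"
    by (intro has_derivative_vector3 has_derivative_mult has_derivative_minus has_derivative_const
        DERIV_compose_FDERIV[OF DERIV_cos] DERIV_compose_FDERIV[OF DERIV_sin] fst snd)
  from D1_D2_eqI(2)[OF S _ this, of "D2 ?X"]
  have X2: "D2 (D2 ?X) ?u = vector [- (r * cos \<theta>), - (r * sin \<theta>), 0]"
    using D2_helicoidal[OF I f] by (auto simp: tangent_\<theta>_def)
  define A B where "A = tangent_r ?p \<theta>" and "B = tangent_\<theta> h r \<theta>"
  define W where "W = norm (cross3 A B)"
  have W2: "W\<^sup>2 = r\<^sup>2 + h\<^sup>2 + r\<^sup>2 * ?p\<^sup>2"
    unfolding W_def A_def B_def by (rule norm_cross_tangents)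
  have trig: "(sin \<theta>)\<^sup>2 + (cos \<theta>)\<^sup>2 = 1" by simp
  have nrm: "x \<bullet> param_normal ?X ?u = (x \<bullet> cross3 A B) / W" for x
    unfolding param_normal_def D1_helicoidal[OF I f r(1)] D2_helicoidal[OF I f r(1)]
      A_def[symmetric] B_def[symmetric] W_def[symmetric] by (simp add: divide_inverse mult.commute)
  have cr: "cross3 A B = vector [h * sin \<theta> - ?p * r * cos \<theta>, - (h * cos \<theta>) - ?p * r * sin \<theta>, r]"
    unfolding A_def B_def by (rule cross_tangents)
  have "D1 (D1 ?X) ?u \<bullet> cross3 A B = r * ?q"
    by (simp add: X1 cr inner_vec_def sum_3)
  moreover have "D2 (D1 ?X) ?u \<bullet> cross3 A B = - h"
  proof -
    have "D2 (D1 ?X) ?u \<bullet> cross3 A B = - h * ((sin \<theta>)\<^sup>2 + (cos \<theta>)\<^sup>2)"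
      unfolding X1 cr inner_vec_def sum_3
        by (simp add: algebra_simps power2_eq_square
            del: sin_cos_squared_add sin_cos_squared_add2 sin_cos_squared_add3)
    thus ?thesis by simp
  qed
  moreover have "D2 (D2 ?X) ?u \<bullet> cross3 A B = r\<^sup>2 * ?p"
  proof -
    have "D2 (D2 ?X) ?u \<bullet> cross3 A B = r\<^sup>2 * ?p * ((sin \<theta>)\<^sup>2 + (cos \<theta>)\<^sup>2)"
      unfolding X2 cr inner_vec_def sum_3
        by (simp add: algebra_simps power2_eq_square
            del: sin_cos_squared_add sin_cos_squared_add2 sin_cos_squared_add3)
    thus ?thesis by simp
  qed
  moreover have "(A \<bullet> A) * (B \<bullet> B) - (A \<bullet> B)\<^sup>2 = W\<^sup>2"
    unfolding W_def norm_cross by (simp add: power2_norm_eq_inner)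
  ultimately have "param_gauss_curvature ?X ?u =
    ((r * ?q / W) * (r\<^sup>2 * ?p / W) - (- h / W)\<^sup>2) / W\<^sup>2"
    unfolding param_gauss_curvature_def nrm
    by (simp add: D1_helicoidal[OF I f r(1)] D2_helicoidal[OF I f r(1)] flip: A_def B_def)
  also have "\<dots> = (r ^ 3 * ?p * ?q - h\<^sup>2) / (W\<^sup>2)\<^sup>2"
    by (simp add: power_divide diff_divide_distrib power2_eq_square power3_eq_cube ac_simps)
  finally show ?thesis by (simp add: W2)
qed

text \<open>
  Let $x$ and $y$ be the components of $n$ along the radial and the angular horizontal direction.
  Orthogonality to the two tangent vectors expresses them by $n_3$, as $x = - p n_3$ and
  $r y = - h n_3$; substitution into $x^2 + y^2 + n_3^2 = 1$ gives the claim.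
\<close>

lemma vertical_component_normal:
  fixes n :: "real^3"
  assumes "r \<noteq> 0" "norm n = 1" "n \<bullet> tangent_r p \<theta> = 0" "n \<bullet> tangent_\<theta> h r \<theta> = 0"
  shows "(n $ 3)\<^sup>2 * (r\<^sup>2 + h\<^sup>2 + r\<^sup>2 * p\<^sup>2) = r\<^sup>2"
proof -
  define x y where "x = n$1 * cos \<theta> + n$2 * sin \<theta>" and "y = n$2 * cos \<theta> - n$1 * sin \<theta>"
  have x: "x = - (n$3 * p)"
    using assms(3) by (simp add: inner_vec_def sum_3 tangent_r_def x_def)
  have y: "r * y = - (n$3 * h)"
    using assms(4) by (simp add: inner_vec_def sum_3 tangent_\<theta>_def y_def algebra_simps)
  have "(norm n)\<^sup>2 = (n$1)\<^sup>2 + (n$2)\<^sup>2 + (n$3)\<^sup>2"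
    unfolding power2_norm_eq_inner inner_vec_def sum_3 by (simp add: power2_eq_square)
  hence n: "(n$1)\<^sup>2 + (n$2)\<^sup>2 + (n$3)\<^sup>2 = 1" using assms(2) by simp
  have "x\<^sup>2 + y\<^sup>2 = ((n$1)\<^sup>2 + (n$2)\<^sup>2) * ((sin \<theta>)\<^sup>2 + (cos \<theta>)\<^sup>2)"
    unfolding x_def y_def
      by (simp add: algebra_simps power2_eq_square
          del: sin_cos_squared_add sin_cos_squared_add2 sin_cos_squared_add3)
  with n have "x\<^sup>2 + y\<^sup>2 + (n$3)\<^sup>2 = 1" by simp
  hence "r\<^sup>2 = r\<^sup>2 * (x\<^sup>2 + y\<^sup>2 + (n$3)\<^sup>2)" by simp
  also have "\<dots> = r\<^sup>2 * x\<^sup>2 + (r * y)\<^sup>2 + r\<^sup>2 * (n$3)\<^sup>2"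
    by (simp add: algebra_simps power_mult_distrib)
  also have "\<dots> = (n$3)\<^sup>2 * (r\<^sup>2 + h\<^sup>2 + r\<^sup>2 * p\<^sup>2)"
    unfolding x y by (simp add: algebra_simps power_mult_distrib)
  finally show ?thesis ..
qed

section \<open>The differential equation\<close>

lemma continuous_nonzero_constant_sign:
  fixes K :: "real \<Rightarrow> real"
  assumes "is_interval I" "continuous_on I K" "\<And>r. r \<in> I \<Longrightarrow> K r \<noteq> 0"
  obtains s where "s \<in> {1, -1}" "\<And>r. r \<in> I \<Longrightarrow> K r = s * \<bar>K r\<bar>"
proof (cases "\<exists>r\<in>I. K r < 0")
  case False
  thus ?thesis by (intro that[of 1]) auto
next
  case True
  then obtain a where a: "a \<in> I" "K a < 0" by blast
  have "connected (K ` I)"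
    using assms(1,2) is_interval_connected connected_continuous_image by blast
  hence conn: "0 \<in> K ` I" if "b \<in> I" "K b > 0" for b
    using connected_contains_Icc[of "K ` I" "K a" "K b"] a that by force
  have "K r < 0" if "r \<in> I" for r
  proof (rule ccontr)
    assume "\<not> K r < 0"
    hence "0 \<in> K ` I" using conn[OF that] assms(3)[OF that] by auto
    thus False using assms(3) by auto
  qed
  thus ?thesis by (intro that[of "-1"]) fastforce+
qed

lemma zero_derivative_constant:
  fixes g :: "real \<Rightarrow> real"
  assumes "is_interval I" "\<And>r. r \<in> I \<Longrightarrow> (g has_real_derivative 0) (at r)"
  obtains c where "\<And>r. r \<in> I \<Longrightarrow> g r = c"
  using has_field_derivative_zero_constant[of I g] assms
  by (metis has_field_derivative_at_within is_interval_convex_1)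

lemma abs_rpow: "\<bar>rpow x a\<bar> = \<bar>x\<bar> powr a"
  by (simp add: rpow_def)

text \<open>
  If $\alpha = p/q$ with $q$ odd, the two exponents of the integrated equation have the odd
  denominator $2p - q$. The numerator of the first one is even, so that power is nonnegative even
  for a negative base.
\<close>

lemma odd_fraction_exponents:
  fixes \<alpha> :: real
  assumes "odd q" "\<alpha> = of_int p / of_int q" "\<alpha> \<noteq> 1/2"
  obtains q' :: int where "odd q'"
    "2 * \<alpha> / (2 * \<alpha> - 1) = of_int (2 * p) / of_int q'"
    "\<alpha> / (1 - 2 * \<alpha>) = of_int (- p) / of_int q'"
proof -
  have q: "real_of_int q \<noteq> 0" using assms(1) by auto
  have "odd (2 * p - q)" using assms(1) by simp
  moreover from this have "real_of_int (2 * p - q) \<noteq> 0" by (metis even_zero of_int_eq_0_iff)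
  moreover have "2 * \<alpha> - 1 = of_int (2 * p - q) / of_int q"
    using q by (simp add: assms(2) diff_divide_distrib)
  ultimately show ?thesis
    using q by (intro that[of "2 * p - q"]) (simp_all add: assms(2) divide_simps, simp_all add: algebra_simps)
qed

lemma half_not_odd_fraction: "odd q \<Longrightarrow> 1/2 \<noteq> real_of_int p / real_of_int q"
proof
  assume "odd q" and eq: "1/2 = real_of_int p / real_of_int q"
  hence "real_of_int q = real_of_int (2 * p)" by (auto simp: field_simps)
  hence "q = 2 * p" by (simp only: of_int_eq_iff)
  thus False using \<open>odd q\<close> by simp
qed

text \<open>
  Here \<open>\<phi>\<close> is the squared vertical component of the normal. Taking absolute values in
  $|K|^\alpha = \sqrt\varphi$ gives $|K| = \varphi^{1/(2\alpha)}$, and $K$ has a constant sign $s$.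
  So $d\varphi/d(r^2) = - s \varphi^{1/(2\alpha)}$ separates: $\varphi e^{r^2}$ is constant if
  $\alpha = 1/2$ (where only $s = 1$ is possible), and otherwise
  $s \varphi^\beta + \beta r^2$ is, with $\beta = (2\alpha - 1)/(2\alpha)$. In the second case the
  base \<open>B\<close> of the powers equals $s \varphi^\beta$ and is negative exactly when $K$ is. Its second
  power is only determined up to sign, which the sign of $df$ absorbs later.
\<close>

lemma translator_ode_solution:
  fixes \<phi> K :: "real \<Rightarrow> real" and h \<alpha> :: real
  assumes I: "is_interval I" and \<alpha>: "\<alpha> \<noteq> 0"
    and pos: "\<And>r. r \<in> I \<Longrightarrow> \<phi> r > 0"
    and der: "\<And>r. r \<in> I \<Longrightarrow> (\<phi> has_real_derivative - 2 * r * K r) (at r)"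
    and K: "continuous_on I K"
    and def: "\<And>r. r \<in> I \<Longrightarrow> rpow_defined (K r) \<alpha>"
    and eq: "\<And>r. r \<in> I \<Longrightarrow> (rpow (K r) \<alpha>)\<^sup>2 = \<phi> r"
  shows "\<alpha> = 1/2 \<Longrightarrow> \<exists>m>0. \<forall>r\<in>I. \<phi> r = m\<^sup>2 * exp (- (r\<^sup>2 + h\<^sup>2))"
    and "\<alpha> \<noteq> 1/2 \<Longrightarrow> \<exists>m. \<forall>r\<in>I.
      let B = m - (2 * \<alpha> - 1) / (2 * \<alpha>) * (r\<^sup>2 + h\<^sup>2) in
        rpow_defined B (2 * \<alpha> / (2 * \<alpha> - 1)) \<and> rpow_defined B (\<alpha> / (1 - 2 * \<alpha>)) \<and>
        rpow B (2 * \<alpha> / (2 * \<alpha> - 1)) = \<phi> r \<and>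
        \<bar>rpow B (\<alpha> / (1 - 2 * \<alpha>))\<bar> = 1 / sqrt (\<phi> r)"
proof -
  have absK: "\<bar>K r\<bar> powr \<alpha> = sqrt (\<phi> r)" if "r \<in> I" for r
    using eq[OF that] by (metis abs_rpow real_sqrt_abs)
  have K0: "K r \<noteq> 0" if "r \<in> I" for r
    using absK[OF that] pos[OF that] by auto
  have absK': "\<bar>K r\<bar> = \<phi> r powr (1 / (2 * \<alpha>))" if "r \<in> I" for r
  proof -
    have "\<bar>K r\<bar> = (\<bar>K r\<bar> powr \<alpha>) powr (1 / \<alpha>)"
      using \<alpha> K0[OF that] by (simp add: powr_powr)
    also have "\<dots> = (\<phi> r powr (1/2)) powr (1 / \<alpha>)"
      using pos[OF that] by (simp add: absK[OF that] powr_half_sqrt)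
    finally show ?thesis by (simp add: powr_powr)
  qed
  obtain s where s: "s \<in> {1, -1}" and Ks: "\<And>r. r \<in> I \<Longrightarrow> K r = s * \<bar>K r\<bar>"
    using continuous_nonzero_constant_sign[OF I K K0] by blast
  \<comment> \<open>A power of a negative number is defined only for a fraction with odd denominator.\<close>
  have frac: "\<exists>p q :: int. odd q \<and> \<alpha> = of_int p / of_int q" if "s = -1" "r \<in> I" for r
  proof -
    have "K r < 0" using Ks[OF that(2)] K0[OF that(2)] that(1) by auto
    thus ?thesis using def[OF that(2)] by (auto simp: rpow_defined_def)
  qed
  show "\<exists>m>0. \<forall>r\<in>I. \<phi> r = m\<^sup>2 * exp (- (r\<^sup>2 + h\<^sup>2))" if half: "\<alpha> = 1/2"
  proof (cases "I = {}")
    case True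
    thus ?thesis by (intro exI[of _ 1]) simp
  next
    case False
    then obtain r0 where r0: "r0 \<in> I" by blast
    have "s = 1" using frac[OF _ r0] half_not_odd_fraction half s by auto
    hence K\<phi>: "K r = \<phi> r" if "r \<in> I" for r
      using Ks[OF that] absK'[OF that] pos[OF that] half by simp
    have "((\<lambda>r. \<phi> r * exp (r\<^sup>2)) has_real_derivative 0) (at r)" if "r \<in> I" for r
      by (rule derivative_eq_intros der[OF that] refl | simp add: K\<phi> that)+
    then obtain c where c: "\<And>r. r \<in> I \<Longrightarrow> \<phi> r * exp (r\<^sup>2) = c"
      using zero_derivative_constant[OF I] by blast
    have cpos: "c > 0" using c[OF r0] pos[OF r0] by (metis exp_gt_zero mult_pos_pos)
    show ?thesis
    proof (intro exI[of _ "sqrt (c * exp (h\<^sup>2))"] conjI ballI)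
      show "sqrt (c * exp (h\<^sup>2)) > 0" using cpos by simp
      show "\<phi> r = (sqrt (c * exp (h\<^sup>2)))\<^sup>2 * exp (- (r\<^sup>2 + h\<^sup>2))" if "r \<in> I" for r
      proof -
        have "exp (h\<^sup>2) * exp (- (r\<^sup>2 + h\<^sup>2)) = exp (- r\<^sup>2)"
          by (simp flip: exp_add)
        moreover have "\<phi> r = c * exp (- r\<^sup>2)"
          using c[OF that] by (simp add: exp_minus field_simps)
        ultimately show ?thesis using cpos by (simp add: mult.assoc)
      qed
    qed
  qed
  show "\<exists>m. \<forall>r\<in>I.
      let B = m - (2 * \<alpha> - 1) / (2 * \<alpha>) * (r\<^sup>2 + h\<^sup>2) in
        rpow_defined B (2 * \<alpha> / (2 * \<alpha> - 1)) \<and> rpow_defined B (\<alpha> / (1 - 2 * \<alpha>)) \<and>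
        rpow B (2 * \<alpha> / (2 * \<alpha> - 1)) = \<phi> r \<and>
        \<bar>rpow B (\<alpha> / (1 - 2 * \<alpha>))\<bar> = 1 / sqrt (\<phi> r)" if nhalf: "\<alpha> \<noteq> 1/2"
  proof -
    define \<beta> where "\<beta> = (2 * \<alpha> - 1) / (2 * \<alpha>)"
    \<comment> \<open>The first equation makes the derivative below vanish, the last one gives the power \<open>-1/2\<close>.\<close>
    have \<beta>: "\<beta> - 1 + 1 / (2 * \<alpha>) = 0" "2 * \<alpha> / (2 * \<alpha> - 1) = 1 / \<beta>"
        "\<beta> \<noteq> 0" "\<beta> * (\<alpha> / (1 - 2 * \<alpha>)) = - (1/2)"
      using \<alpha> nhalf by (simp_all add: \<beta>_def field_simps)
    have "((\<lambda>r. s * \<phi> r powr \<beta> + \<beta> * (r\<^sup>2 + h\<^sup>2)) has_real_derivative 0) (at r)" if r: "r \<in> I" for r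
    proof -
      have "\<phi> r powr (\<beta> - 1) * \<bar>K r\<bar> = 1"
        using pos[OF r] \<beta>(1) by (simp add: absK'[OF r] flip: powr_add)
      moreover have "s * s = 1" using s by auto
      ultimately have *: "s * (\<beta> * \<phi> r powr (\<beta> - 1) * (- 2 * r * K r)) + \<beta> * (2 * r) = 0"
        using Ks[OF r] by algebra
      have "((\<lambda>r. \<phi> r powr \<beta>) has_real_derivative \<beta> * \<phi> r powr (\<beta> - 1) * (- 2 * r * K r)) (at r)"
        using DERIV_chain2[OF has_real_derivative_powr[OF pos[OF r]] der[OF r]] by simp
      moreover have "((\<lambda>r. r\<^sup>2 + h\<^sup>2) has_real_derivative 2 * r) (at r)"
        by (auto intro!: derivative_eq_intros)
      ultimately have "((\<lambda>r. s * \<phi> r powr \<beta> + \<beta> * (r\<^sup>2 + h\<^sup>2)) has_real_derivative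
          s * (\<beta> * \<phi> r powr (\<beta> - 1) * (- 2 * r * K r)) + \<beta> * (2 * r)) (at r)"
        by (intro DERIV_add DERIV_cmult)
      thus ?thesis unfolding * .
    qed
    then obtain m where m: "\<And>r. r \<in> I \<Longrightarrow> s * \<phi> r powr \<beta> + \<beta> * (r\<^sup>2 + h\<^sup>2) = m"
      using zero_derivative_constant[OF I] by blast
    show ?thesis
      unfolding Let_def \<beta>_def[symmetric]
    proof (intro exI[of _ m] ballI)
      fix r assume r: "r \<in> I"
      define B where "B = m - \<beta> * (r\<^sup>2 + h\<^sup>2)"
      have B: "B = s * \<phi> r powr \<beta>" using m[OF r] by (simp add: B_def)
      have absB: "\<bar>B\<bar> = \<phi> r powr \<beta>" using s by (auto simp: B)
      have absB1: "\<bar>B\<bar> powr (1 / \<beta>) = \<phi> r"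
        using pos[OF r] \<beta>(3) by (simp add: absB powr_powr)
      have absB2: "\<bar>B\<bar> powr (\<alpha> / (1 - 2 * \<alpha>)) = 1 / sqrt (\<phi> r)"
        unfolding absB powr_powr \<beta>(4) powr_minus powr_half_sqrt[OF less_imp_le[OF pos[OF r]]]
        by (rule inverse_eq_divide)
      have "rpow_defined B (2 * \<alpha> / (2 * \<alpha> - 1)) \<and> rpow_defined B (\<alpha> / (1 - 2 * \<alpha>)) \<and>
        rpow B (2 * \<alpha> / (2 * \<alpha> - 1)) = \<phi> r"
      proof (cases "s = 1")
        case True
        hence "B > 0" using pos[OF r] by (simp add: B)
        thus ?thesis using absB1 by (simp add: rpow_defined_def rpow_pos \<beta>(2))
      next
        case False
        hence s1: "s = -1" using s by simp
        hence neg: "B < 0" using pos[OF r] by (simp add: B)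
        obtain p q :: int where "odd q" "\<alpha> = of_int p / of_int q" using frac[OF s1 r] by blast
        then obtain q' :: int where q': "odd q'"
          "2 * \<alpha> / (2 * \<alpha> - 1) = of_int (2 * p) / of_int q'"
          "\<alpha> / (1 - 2 * \<alpha>) = of_int (- p) / of_int q'"
          using odd_fraction_exponents[OF _ _ nhalf] by metis
        have "rpow B (2 * \<alpha> / (2 * \<alpha> - 1)) = \<bar>B\<bar> powr (2 * \<alpha> / (2 * \<alpha> - 1))"
          unfolding rpow_def using q'(1,2) by (metis dvd_triv_left)
        thus ?thesis
          using neg q' absB1 unfolding rpow_defined_def by (metis \<beta>(2))
      qed
      thus "rpow_defined (m - \<beta> * (r\<^sup>2 + h\<^sup>2)) (2 * \<alpha> / (2 * \<alpha> - 1)) \<and>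
        rpow_defined (m - \<beta> * (r\<^sup>2 + h\<^sup>2)) (\<alpha> / (1 - 2 * \<alpha>)) \<and>
        rpow (m - \<beta> * (r\<^sup>2 + h\<^sup>2)) (2 * \<alpha> / (2 * \<alpha> - 1)) = \<phi> r \<and>
        \<bar>rpow (m - \<beta> * (r\<^sup>2 + h\<^sup>2)) (\<alpha> / (1 - 2 * \<alpha>))\<bar> = 1 / sqrt (\<phi> r)"
        using absB2 unfolding B_def[symmetric] abs_rpow by simp
    qed
  qed
qed

section \<open>The Bour function and its inverse\<close>

lemma bour_function_square: "(bour_function h r)\<^sup>2 = r\<^sup>2 + h\<^sup>2"
  by (simp add: bour_function_def)

definition bour_radius :: "real \<Rightarrow> real \<Rightarrow> real" where
  "bour_radius h U = sqrt (U\<^sup>2 - h\<^sup>2)"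

lemma bour_radius_bour_function: "r > 0 \<Longrightarrow> bour_radius h (bour_function h r) = r"
  by (simp add: bour_radius_def bour_function_square)

lemma bour_function_bour_radius:
  assumes "\<bar>h\<bar> < U"
  shows "bour_function h (bour_radius h U) = U" and "bour_radius h U > 0"
proof -
  have "h\<^sup>2 < U\<^sup>2" using power_strict_mono[OF assms, of 2] by simp
  thus "bour_radius h U > 0" "bour_function h (bour_radius h U) = U"
    using assms by (simp_all add: bour_radius_def bour_function_def)
qed

lemma bour_function_image:
  assumes "I \<subseteq> {0<..}"
  shows "bour_function h ` I = {\<bar>h\<bar><..} \<inter> bour_radius h -` I"
proof
  have "\<bar>h\<bar> < bour_function h r" if "r \<in> I" for r
  proof -
    have "sqrt (h\<^sup>2) < bour_function h r"
      unfolding bour_function_def using assms that by (subst real_sqrt_less_iff) auto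
    thus ?thesis by simp
  qed
  thus "bour_function h ` I \<subseteq> {\<bar>h\<bar><..} \<inter> bour_radius h -` I"
    using assms bour_radius_bour_function by (auto simp: subset_iff)
  show "{\<bar>h\<bar><..} \<inter> bour_radius h -` I \<subseteq> bour_function h ` I"
  proof
    fix U assume "U \<in> {\<bar>h\<bar><..} \<inter> bour_radius h -` I"
    thus "U \<in> bour_function h ` I"
      using bour_function_bour_radius(1)[of h U, symmetric] by blast
  qed
qed

lemma bour_radius_has_derivative:
  assumes "\<bar>h\<bar> < U"
  shows "(bour_radius h has_real_derivative U / bour_radius h U) (at U)"
proof -
  have "U\<^sup>2 - h\<^sup>2 > 0" using bour_function_bour_radius(2)[OF assms] by (simp add: bour_radius_def)
  hence "((\<lambda>U. sqrt (U\<^sup>2 - h\<^sup>2)) has_real_derivative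
      inverse (sqrt (U\<^sup>2 - h\<^sup>2)) / 2 * (2 * U)) (at U)"
    by (intro DERIV_chain2[OF DERIV_real_sqrt]) (auto intro!: derivative_eq_intros)
  thus ?thesis by (simp add: bour_radius_def[abs_def] field_simps)
qed

lemma smooth_on_bour_radius: "smooth_on {\<bar>h\<bar><..} (bour_radius h)"
  unfolding bour_radius_def
proof (rule smooth_on_compose[OF _ smooth_on_sqrt])
  show "smooth_on {\<bar>h\<bar><..} (\<lambda>U. U\<^sup>2 - h\<^sup>2)"
    unfolding power2_eq_square
    by (intro smooth_on_diff smooth_on_mult smooth_on_const
        smooth_on_bounded_linear bounded_linear_ident open_greaterThan)
  show "(\<lambda>U. U\<^sup>2 - h\<^sup>2) ` {\<bar>h\<bar><..} \<subseteq> {0<..}"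
    using bour_function_bour_radius(2) by (force simp: bour_radius_def)
qed simp

lemma homeomorphism_bour_radius:
  assumes "I \<subseteq> {0<..}"
  shows "homeomorphism (bour_function h ` I) I (bour_radius h) (bour_function h)"
proof (rule homeomorphismI)
  show "continuous_on (bour_function h ` I) (bour_radius h)"
    "continuous_on I (bour_function h)"
    unfolding bour_radius_def bour_function_def by (intro continuous_intros)+
  show "bour_radius h (bour_function h r) = r" if "r \<in> I" for r
    using assms that bour_radius_bour_function by auto
  thus "bour_radius h ` bour_function h ` I \<subseteq> I"
    "\<And>U. U \<in> bour_function h ` I \<Longrightarrow> bour_function h (bour_radius h U) = U"
    by auto
qed simp

section \<open>The translator equation on a helicoidal surface\<close>

text \<open>
  The key identity $K = - d(\nu^2)/d(U^2)$, written with $d(U^2) = 2 r\,dr$: the expression in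
  the last factor is the Gauss curvature of the helicoidal surface with slope \<open>p\<close>.
\<close>

lemma normal_square_has_derivative:
  assumes p: "(p has_real_derivative q) (at r)" and r: "r > 0"
  shows "((\<lambda>r. r\<^sup>2 / (r\<^sup>2 + h\<^sup>2 + r\<^sup>2 * (p r)\<^sup>2)) has_real_derivative
    - 2 * r * ((r ^ 3 * p r * q - h\<^sup>2) / (r\<^sup>2 + h\<^sup>2 + r\<^sup>2 * (p r)\<^sup>2)\<^sup>2)) (at r)"
proof -
  let ?W = "r\<^sup>2 + h\<^sup>2 + r\<^sup>2 * (p r)\<^sup>2"
  have W: "?W \<noteq> 0" using r by (smt (verit) zero_le_power2 zero_less_power2 mult_nonneg_nonneg)
  have "((\<lambda>r. r\<^sup>2 / (r\<^sup>2 + h\<^sup>2 + r\<^sup>2 * (p r)\<^sup>2)) has_real_derivative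
    (2 * r * ?W - r\<^sup>2 * (2 * r + (2 * r * (p r)\<^sup>2 + r\<^sup>2 * (2 * p r * q)))) / (?W * ?W)) (at r)"
    by (rule derivative_eq_intros p W refl | simp)+
  moreover have "2 * r * ?W - r\<^sup>2 * (2 * r + (2 * r * (p r)\<^sup>2 + r\<^sup>2 * (2 * p r * q)))
      = - 2 * r * (r ^ 3 * p r * q - h\<^sup>2)"
    by (simp add: algebra_simps power2_eq_square power3_eq_cube)
  ultimately show ?thesis by (simp add: power2_eq_square)
qed

text \<open>
  Everything is invariant under the helicoidal motions, so it suffices to evaluate the translator
  equation on the profile curve \<open>\<theta> = 0\<close>. Squaring it removes the choice of orientation.
\<close>

lemma helicoidal_translator_normal_ode:
  assumes trans: "K_translator \<alpha> (vector [0, 0, 1]) \<Sigma>"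
    and surf: "helicoidal_surface h I f \<Sigma>" and h: "h \<noteq> 0" and r: "r \<in> I"
  defines "k \<equiv> (r ^ 3 * deriv f r * deriv (deriv f) r - h\<^sup>2) /
      (r\<^sup>2 + h\<^sup>2 + r\<^sup>2 * (deriv f r)\<^sup>2)\<^sup>2"
  shows "rpow_defined k \<alpha>"
    and "(rpow k \<alpha>)\<^sup>2 = r\<^sup>2 / (r\<^sup>2 + h\<^sup>2 + r\<^sup>2 * (deriv f r)\<^sup>2)"
proof -
  have I: "open I" "I \<subseteq> {0<..}" and f: "smooth_on I f"
    using surf unfolding helicoidal_surface_def by auto
  have r0: "r > 0" using r I(2) by auto
  let ?X = "helicoidal_param h f" and ?u = "(r, 0 :: real)"
  have deriv_id: "deriv (\<lambda>r :: real. r) U = 1" for U :: real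
    by (rule DERIV_imp_deriv) simp
  have lp: "local_parametrization \<Sigma> (I \<times> UNIV) ?X" and img: "?X ` (I \<times> UNIV) = \<Sigma>"
    using helicoidal_reparametrization[OF surf h I(1), of "\<lambda>r. r" "\<lambda>r. r" "\<lambda>_. 0"]
      smooth_on_bounded_linear[OF I(1) bounded_linear_ident] smooth_on_const[OF I(1), of "0 :: real"]
    by (simp_all add: homeomorphism_ident deriv_id)
  obtain N K where N: "is_unit_normal \<Sigma> N" and K: "is_gauss_curvature \<Sigma> K"
    and NK: "\<And>q. q \<in> \<Sigma> \<Longrightarrow> rpow_defined (K q) \<alpha> \<and> rpow (K q) \<alpha> = N q \<bullet> vector [0, 0, 1]"
    using trans unfolding K_translator_def by blast
  have u: "?u \<in> I \<times> UNIV" using r by simp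
  hence q: "?X ?u \<in> \<Sigma>" using img by blast
  have "K (?X ?u) = param_gauss_curvature ?X ?u"
    using K lp u unfolding is_gauss_curvature_def by blast
  hence Kk: "K (?X ?u) = k"
    unfolding k_def gauss_curvature_helicoidal[OF I(1) f r r0] .
  have "norm (N (?X ?u)) = 1" "N (?X ?u) \<bullet> D1 ?X ?u = 0" "N (?X ?u) \<bullet> D2 ?X ?u = 0"
    using N lp u q unfolding is_unit_normal_def by blast+
  hence "(N (?X ?u) $ 3)\<^sup>2 * (r\<^sup>2 + h\<^sup>2 + r\<^sup>2 * (deriv f r)\<^sup>2) = r\<^sup>2"
    using vertical_component_normal[of r "N (?X ?u)" "deriv f r" 0 h] r0
    by (simp add: D1_helicoidal[OF I(1) f r] D2_helicoidal[OF I(1) f r])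
  moreover have "N (?X ?u) \<bullet> vector [0, 0, 1] = N (?X ?u) $ 3"
    by (simp add: inner_vec_def sum_3)
  moreover have "r\<^sup>2 + h\<^sup>2 + r\<^sup>2 * (deriv f r)\<^sup>2 > 0"
    using r0 by (simp add: add_pos_nonneg)
  ultimately show "rpow_defined k \<alpha>"
    and "(rpow k \<alpha>)\<^sup>2 = r\<^sup>2 / (r\<^sup>2 + h\<^sup>2 + r\<^sup>2 * (deriv f r)\<^sup>2)"
    using NK[OF q] by (simp_all add: Kk field_simps)
qed

text \<open>
  The equation for \<open>\<phi>\<close> says that the radicand equals $\varphi r^2 p^2$. Hence the square root times
  $|y| = \varphi^{-1/2}$ is $r |p|$, and the two signs, those of \<open>p\<close> and \<open>y\<close>, combine into
  \<open>\<epsilon>\<close>. The factor \<open>U / r\<close> on the left is $dr/dU$.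
\<close>

lemma profile_derivative_formula:
  fixes \<phi> p r h U y :: real
  assumes r: "r > 0" and \<phi>: "\<phi> > 0" "\<phi> * (r\<^sup>2 + h\<^sup>2 + r\<^sup>2 * p\<^sup>2) = r\<^sup>2"
    and U: "U\<^sup>2 = r\<^sup>2 + h\<^sup>2" and y: "\<bar>y\<bar> = 1 / sqrt \<phi>"
  shows "U\<^sup>2 * (1 - \<phi>) - h\<^sup>2 \<ge> 0"
    and "\<exists>\<epsilon>\<in>{1, -1}. p * (U / r) = \<epsilon> * U / (U\<^sup>2 - h\<^sup>2) * sqrt (U\<^sup>2 * (1 - \<phi>) - h\<^sup>2) * y"
proof -
  have eq: "U\<^sup>2 * (1 - \<phi>) - h\<^sup>2 = \<phi> * (r * p)\<^sup>2"
    using \<phi>(2) unfolding U by (simp add: algebra_simps power_mult_distrib)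
  thus "U\<^sup>2 * (1 - \<phi>) - h\<^sup>2 \<ge> 0" using \<phi>(1) by simp
  have "sqrt (\<phi> * (r * p)\<^sup>2) * \<bar>y\<bar> = r * \<bar>p\<bar>"
    using \<phi>(1) r by (simp add: y real_sqrt_mult abs_mult)
  hence "\<bar>sqrt (\<phi> * (r * p)\<^sup>2) * y\<bar> = \<bar>r * p\<bar>"
    using r \<phi>(1) by (simp add: abs_mult)
  then obtain \<epsilon> where \<epsilon>: "\<epsilon> \<in> {1, -1}" "sqrt (\<phi> * (r * p)\<^sup>2) * y = \<epsilon> * (r * p)"
    unfolding abs_eq_iff by (metis insertCI mult_1 mult_minus1)
  have "\<epsilon> * U / (U\<^sup>2 - h\<^sup>2) * sqrt (U\<^sup>2 * (1 - \<phi>) - h\<^sup>2) * y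
      = \<epsilon> * U / r\<^sup>2 * (sqrt (\<phi> * (r * p)\<^sup>2) * y)"
    unfolding eq by (simp add: U)
  also have "\<dots> = p * (U / r)"
    unfolding \<epsilon>(2) using \<epsilon>(1) r by (auto simp: power2_eq_square)
  finally show "\<exists>\<epsilon>\<in>{1, -1}. p * (U / r) =
      \<epsilon> * U / (U\<^sup>2 - h\<^sup>2) * sqrt (U\<^sup>2 * (1 - \<phi>) - h\<^sup>2) * y"
    using \<epsilon>(1) by metis
qed

section \<open>Helicoidal translators in Bour coordinates\<close>

theorem theorem3p3:
  fixes \<alpha> h :: real and I :: "real set" and f :: "real \<Rightarrow> real" and \<Sigma> :: "(real^3) set"
  assumes "\<alpha> \<noteq> 0"
    and "K_translator \<alpha> (vector [0, 0, 1]) \<Sigma>"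
    and "\<not> constant_gauss_curvature \<Sigma>"
    and "h \<noteq> 0"
    and "helicoidal_surface h I f \<Sigma>"
  shows "\<exists>(J :: real set) (F :: real \<Rightarrow> real) (\<Theta> :: real \<Rightarrow> real).
    J = bour_function h ` I \<and>
    (\<forall>r\<in>I. F (bour_function h r) = f r) \<and>
    is_bour_angle h I f (\<lambda>r. \<Theta> (bour_function h r)) \<and>
    local_parametrization \<Sigma> (J \<times> UNIV) (bour_param h F \<Theta>) \<and>
    bour_param h F \<Theta> ` (J \<times> UNIV) = \<Sigma> \<and>
    (\<forall>U\<in>J. (\<Theta> has_real_derivative h / U\<^sup>2 * deriv F U) (at U)) \<and>
    (\<exists>m :: real.
      (\<alpha> = 1/2 \<longrightarrow>
        m > 0 \<and>
        (\<forall>U\<in>J.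
          U\<^sup>2 * (1 - m\<^sup>2 * exp (- U\<^sup>2)) - h\<^sup>2 \<ge> 0 \<and>
          (\<exists>\<epsilon>\<in>{1, -1}.
            (F has_real_derivative
              \<epsilon> * inverse m * U / (U\<^sup>2 - h\<^sup>2)
                * sqrt (U\<^sup>2 * (1 - m\<^sup>2 * exp (- U\<^sup>2)) - h\<^sup>2)
                * exp (U\<^sup>2 / 2)) (at U)))) \<and>
      (\<alpha> \<noteq> 1/2 \<longrightarrow>
        (\<forall>U\<in>J.
          let B = m - (2 * \<alpha> - 1) / (2 * \<alpha>) * U\<^sup>2 in
          rpow_defined B (2 * \<alpha> / (2 * \<alpha> - 1)) \<and>
          rpow_defined B (\<alpha> / (1 - 2 * \<alpha>)) \<and>
          U\<^sup>2 * (1 - rpow B (2 * \<alpha> / (2 * \<alpha> - 1))) - h\<^sup>2 \<ge> 0 \<and>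
          (\<exists>\<epsilon>\<in>{1, -1}.
            (F has_real_derivative
              \<epsilon> * U / (U\<^sup>2 - h\<^sup>2)
                * sqrt (U\<^sup>2 * (1 - rpow B (2 * \<alpha> / (2 * \<alpha> - 1))) - h\<^sup>2)
                * rpow B (\<alpha> / (1 - 2 * \<alpha>))) (at U)))))"
proof -
  have I: "open I" "is_interval I" "I \<noteq> {}" "I \<subseteq> {0<..}" and f: "smooth_on I f"
    using assms(5) unfolding helicoidal_surface_def by auto
  have pos: "r > 0" if "r \<in> I" for r using I(4) that by auto
  define J where "J = bour_function h ` I"
  have Jeq: "J = {\<bar>h\<bar><..} \<inter> bour_radius h -` I"
    unfolding J_def by (rule bour_function_image[OF I(4)])
  have J: "open J"
    unfolding Jeq using I(1)
    by (intro open_Int open_vimage)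
       (auto simp: bour_radius_def intro!: continuous_intros)
  have J\<rho>: "\<bar>h\<bar> < U" "bour_radius h U \<in> I" "U\<^sup>2 = (bour_radius h U)\<^sup>2 + h\<^sup>2" if "U \<in> J" for U
    using that bour_function_bour_radius(1)[of h U] bour_function_square[of h "bour_radius h U"]
    unfolding Jeq by auto
  have \<rho>': "(bour_radius h has_real_derivative U / bour_radius h U) (at U)" if "U \<in> J" for U
    by (rule bour_radius_has_derivative[OF J\<rho>(1)[OF that]])
  have \<rho>: "smooth_on J (bour_radius h)"
    using J\<rho>(1) smooth_on_compose[OF J smooth_on_bour_radius
        smooth_on_bounded_linear[OF J bounded_linear_ident]] by auto
  \<comment> \<open>The angle \<open>\<Theta>\<close> is an antiderivative \<open>T\<close> of \<open>g\<close>, expressed in \<open>U\<close>.\<close>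
  define g where "g r = h / (r\<^sup>2 + h\<^sup>2) * deriv f r" for r
  have cont: "continuous_on I (deriv f)" "continuous_on I (deriv (deriv f))"
    using smooth_on_real_deriv(1)[OF I(1)] f C_on.simps(1) unfolding smooth_on_def by blast+
  have sq: "r\<^sup>2 + h\<^sup>2 \<noteq> 0" for r using \<open>h \<noteq> 0\<close> by simp
  have "smooth_on I g"
  proof -
    have inv: "smooth_on I (\<lambda>r. (r\<^sup>2 + h\<^sup>2) powr (-1))"
      unfolding power2_eq_square using sq
      by (intro smooth_on_compose[OF I(1) smooth_on_powr[of "-1"]] smooth_on_add smooth_on_mult
          smooth_on_const smooth_on_bounded_linear bounded_linear_ident I(1))
         (auto simp: power2_eq_square less_le)
    have "smooth_on I (\<lambda>r. h * (r\<^sup>2 + h\<^sup>2) powr (-1) * deriv f r)"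
      by (intro smooth_on_mult smooth_on_const I(1) inv smooth_on_real_deriv(1) f)
    thus ?thesis
      by (rule smooth_on_cong[OF I(1)]) (simp add: g_def powr_minus divide_inverse)
  qed
  moreover from this have "continuous_on I g"
    unfolding smooth_on_def using C_on.simps(1) by blast
  then obtain T where T: "\<And>r. r \<in> I \<Longrightarrow> (T has_real_derivative g r) (at r)"
    using antiderivative_open_interval[OF I(1-3)] by blast
  ultimately have smT: "smooth_on I T"
    using smooth_on_realI[OF I(1)] by blast
  define F \<Theta> where "F U = f (bour_radius h U)" and "\<Theta> U = T (bour_radius h U)" for U
  have sm\<Theta>: "smooth_on J \<Theta>"
    unfolding \<Theta>_def by (rule smooth_on_compose[OF J smT \<rho>]) (use J\<rho>(2) in auto)
  have F': "(F has_real_derivative deriv f (bour_radius h U) * (U / bour_radius h U)) (at U)"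
    if "U \<in> J" for U
    unfolding F_def
    by (rule DERIV_chain2[OF smooth_on_real_deriv(2)[OF I(1) f J\<rho>(2)[OF that]] \<rho>'[OF that]])
  have \<Theta>': "(\<Theta> has_real_derivative h / U\<^sup>2 * deriv F U) (at U)" if U: "U \<in> J" for U
  proof -
    have "(\<Theta> has_real_derivative g (bour_radius h U) * (U / bour_radius h U)) (at U)"
      unfolding \<Theta>_def by (rule DERIV_chain2[OF T[OF J\<rho>(2)[OF U]] \<rho>'[OF U]])
    thus ?thesis
      unfolding g_def DERIV_imp_deriv[OF F'[OF U]] J\<rho>(3)[OF U, symmetric] by (simp add: mult.assoc)
  qed
  have angle: "is_bour_angle h I f (\<lambda>r. \<Theta> (bour_function h r))"
    unfolding is_bour_angle_def
  proof
    fix r assume r: "r \<in> I"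
    have "((\<lambda>r. \<Theta> (bour_function h r)) has_real_derivative g r) (at r)"
    proof (rule has_field_derivative_transform_within_open[OF T[OF r] I(1) r])
      show "T x = \<Theta> (bour_function h x)" if "x \<in> I" for x
        using pos[OF that] by (simp add: \<Theta>_def bour_radius_bour_function)
    qed
    thus "((\<lambda>r. \<Theta> (bour_function h r)) has_real_derivative h / (r\<^sup>2 + h\<^sup>2) * deriv f r) (at r)"
      by (simp add: g_def)
  qed
  have X: "bour_param h F \<Theta> = (\<lambda>(U, t). helicoidal_param h f (bour_radius h U, t - \<Theta> U))"
    by (simp add: bour_param_def helicoidal_param_def F_def bour_radius_def)
  have dnz: "deriv (bour_radius h) U \<noteq> 0" if "U \<in> J" for U
    using DERIV_imp_deriv[OF \<rho>'[OF that]] J\<rho>(1)[OF that] pos[OF J\<rho>(2)[OF that]] by auto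
  note par = helicoidal_reparametrization[OF assms(5,4) J
      homeomorphism_bour_radius[OF I(4), of h, folded J_def] \<rho> dnz sm\<Theta>, folded X]

  \<comment> \<open>The squared vertical component of the normal and the Gauss curvature, as functions of \<open>r\<close>.\<close>
  define \<phi> K where "\<phi> r = r\<^sup>2 / (r\<^sup>2 + h\<^sup>2 + r\<^sup>2 * (deriv f r)\<^sup>2)"
    and "K r = (r ^ 3 * deriv f r * deriv (deriv f) r - h\<^sup>2) /
      (r\<^sup>2 + h\<^sup>2 + r\<^sup>2 * (deriv f r)\<^sup>2)\<^sup>2" for r
  have W: "r\<^sup>2 + h\<^sup>2 + r\<^sup>2 * (deriv f r)\<^sup>2 > 0" if "r \<in> I" for r
    using pos[OF that] by (simp add: add_pos_nonneg)
  have \<phi>: "\<phi> r > 0" "\<phi> r * (r\<^sup>2 + h\<^sup>2 + r\<^sup>2 * (deriv f r)\<^sup>2) = r\<^sup>2" if "r \<in> I" for r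
    using W[OF that] pos[OF that] by (simp_all add: \<phi>_def)
  have \<phi>': "(\<phi> has_real_derivative - 2 * r * K r) (at r)" if "r \<in> I" for r
    unfolding \<phi>_def K_def
    by (rule normal_square_has_derivative[OF smooth_on_real_deriv(2)[OF I(1)
          smooth_on_real_deriv(1)[OF I(1) f] that] pos[OF that]])
  have Kcont: "continuous_on I K"
    unfolding K_def using W by (intro continuous_intros cont) force
  note ode = helicoidal_translator_normal_ode[OF assms(2,5,4), folded \<phi>_def K_def]
  note sol = translator_ode_solution[OF I(2) \<open>\<alpha> \<noteq> 0\<close> \<phi>(1) \<phi>' Kcont ode, of h]
  note formula = profile_derivative_formula[OF pos \<phi> J\<rho>(3), OF J\<rho>(2) J\<rho>(2) J\<rho>(2)]

  have half: "\<exists>m>0. \<forall>U\<in>J. U\<^sup>2 * (1 - m\<^sup>2 * exp (- U\<^sup>2)) - h\<^sup>2 \<ge> 0 \<and>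
      (\<exists>\<epsilon>\<in>{1, -1}. (F has_real_derivative \<epsilon> * inverse m * U / (U\<^sup>2 - h\<^sup>2)
        * sqrt (U\<^sup>2 * (1 - m\<^sup>2 * exp (- U\<^sup>2)) - h\<^sup>2) * exp (U\<^sup>2 / 2)) (at U))"
    if \<alpha>: "\<alpha> = 1/2"
  proof -
    obtain m where m: "m > 0" "\<And>r. r \<in> I \<Longrightarrow> \<phi> r = m\<^sup>2 * exp (- (r\<^sup>2 + h\<^sup>2))"
      using sol(1)[OF _ _ _ _ \<alpha>] by auto
    show ?thesis
    proof (intro exI[of _ m] conjI ballI)
      show "m > 0" by (rule m(1))
      fix U assume U: "U \<in> J"
      let ?r = "bour_radius h U"
      have \<phi>U: "\<phi> ?r = m\<^sup>2 * exp (- U\<^sup>2)" using m(2)[OF J\<rho>(2)[OF U]] J\<rho>(3)[OF U] by simp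
      \<comment> \<open>Here \<open>inverse m * exp (U\<^sup>2 / 2)\<close> is the factor $\varphi^{-1/2}$.\<close>
      have "sqrt (\<phi> ?r) = m * exp (- (U\<^sup>2 / 2))"
      proof (rule real_sqrt_unique)
        show "(m * exp (- (U\<^sup>2 / 2)))\<^sup>2 = \<phi> ?r"
          unfolding \<phi>U power_mult_distrib exp_double[symmetric] by simp
      qed (use m(1) in simp)
      hence "\<bar>inverse m * exp (U\<^sup>2 / 2)\<bar> = 1 / sqrt (\<phi> ?r)"
        using m(1) by (simp only: abs_mult exp_minus) (simp add: field_simps)
      note fo = formula[OF U U U U this, unfolded \<phi>U]
      show "U\<^sup>2 * (1 - m\<^sup>2 * exp (- U\<^sup>2)) - h\<^sup>2 \<ge> 0" by (rule fo(1))
      show "\<exists>\<epsilon>\<in>{1, -1}. (F has_real_derivative \<epsilon> * inverse m * U / (U\<^sup>2 - h\<^sup>2)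
        * sqrt (U\<^sup>2 * (1 - m\<^sup>2 * exp (- U\<^sup>2)) - h\<^sup>2) * exp (U\<^sup>2 / 2)) (at U)"
        using fo(2) F'[OF U] by (auto simp: ac_simps)
    qed
  qed
  have nhalf: "\<exists>m. \<forall>U\<in>J. let B = m - (2 * \<alpha> - 1) / (2 * \<alpha>) * U\<^sup>2 in
          rpow_defined B (2 * \<alpha> / (2 * \<alpha> - 1)) \<and>
          rpow_defined B (\<alpha> / (1 - 2 * \<alpha>)) \<and>
          U\<^sup>2 * (1 - rpow B (2 * \<alpha> / (2 * \<alpha> - 1))) - h\<^sup>2 \<ge> 0 \<and>
          (\<exists>\<epsilon>\<in>{1, -1}.
            (F has_real_derivative
              \<epsilon> * U / (U\<^sup>2 - h\<^sup>2)
                * sqrt (U\<^sup>2 * (1 - rpow B (2 * \<alpha> / (2 * \<alpha> - 1))) - h\<^sup>2)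
                * rpow B (\<alpha> / (1 - 2 * \<alpha>))) (at U))"
    if \<alpha>: "\<alpha> \<noteq> 1/2"
  proof -
    obtain m where m: "\<And>r. r \<in> I \<Longrightarrow>
      let B = m - (2 * \<alpha> - 1) / (2 * \<alpha>) * (r\<^sup>2 + h\<^sup>2) in
        rpow_defined B (2 * \<alpha> / (2 * \<alpha> - 1)) \<and> rpow_defined B (\<alpha> / (1 - 2 * \<alpha>)) \<and>
        rpow B (2 * \<alpha> / (2 * \<alpha> - 1)) = \<phi> r \<and>
        \<bar>rpow B (\<alpha> / (1 - 2 * \<alpha>))\<bar> = 1 / sqrt (\<phi> r)"
      using sol(2)[OF _ _ _ _ \<alpha>] by blast
    show ?thesis
    proof (intro exI[of _ m] ballI)
      fix U assume U: "U \<in> J"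
      let ?r = "bour_radius h U"
      define B where "B = m - (2 * \<alpha> - 1) / (2 * \<alpha>) * U\<^sup>2"
      have B: "rpow_defined B (2 * \<alpha> / (2 * \<alpha> - 1))" "rpow_defined B (\<alpha> / (1 - 2 * \<alpha>))"
        "rpow B (2 * \<alpha> / (2 * \<alpha> - 1)) = \<phi> ?r"
        "\<bar>rpow B (\<alpha> / (1 - 2 * \<alpha>))\<bar> = 1 / sqrt (\<phi> ?r)"
        using m[OF J\<rho>(2)[OF U]] unfolding Let_def J\<rho>(3)[OF U, symmetric] B_def[symmetric] by auto
      note fo = formula[OF U U U U B(4)]
      show "let B = m - (2 * \<alpha> - 1) / (2 * \<alpha>) * U\<^sup>2 in
          rpow_defined B (2 * \<alpha> / (2 * \<alpha> - 1)) \<and>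
          rpow_defined B (\<alpha> / (1 - 2 * \<alpha>)) \<and>
          U\<^sup>2 * (1 - rpow B (2 * \<alpha> / (2 * \<alpha> - 1))) - h\<^sup>2 \<ge> 0 \<and>
          (\<exists>\<epsilon>\<in>{1, -1}.
            (F has_real_derivative
              \<epsilon> * U / (U\<^sup>2 - h\<^sup>2)
                * sqrt (U\<^sup>2 * (1 - rpow B (2 * \<alpha> / (2 * \<alpha> - 1))) - h\<^sup>2)
                * rpow B (\<alpha> / (1 - 2 * \<alpha>))) (at U))"
        unfolding Let_def B_def[symmetric] B(3)
        using B(1,2) fo F'[OF U] by (metis (no_types))
    qed
  qed
  have merge: "\<exists>m. (c \<longrightarrow> m > 0 \<and> P m) \<and> (\<not> c \<longrightarrow> Q m)"
    if "c \<Longrightarrow> \<exists>m>0. P m" "\<not> c \<Longrightarrow> \<exists>m. Q m" for c and P Q :: "real \<Rightarrow> bool"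
    using that by metis
  show ?thesis
  proof (rule exI[of _ J], rule exI[of _ F], rule exI[of _ \<Theta>], intro conjI)
    show "J = bour_function h ` I" by (rule J_def)
    show "\<forall>r\<in>I. F (bour_function h r) = f r"
      using pos by (simp add: F_def bour_radius_bour_function)
    show "is_bour_angle h I f (\<lambda>r. \<Theta> (bour_function h r))" by (rule angle)
    show "local_parametrization \<Sigma> (J \<times> UNIV) (bour_param h F \<Theta>)" by (rule par(1))
    show "bour_param h F \<Theta> ` (J \<times> UNIV) = \<Sigma>" by (rule par(2))
    show "\<forall>U\<in>J. (\<Theta> has_real_derivative h / U\<^sup>2 * deriv F U) (at U)" using \<Theta>' by blast
  qed (rule merge[OF half nhalf])
qed

end
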